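(* Let $q$ be a prime power and let $f \in \mathbb{F}_q[x]$ be an exceptional polynomial over $\mathbb{F}_q$ of degree $d \ge 1$. Then $\gcd(d, q-1) = 1$.
   Context: $\mathbb{F}_q$ denotes the finite field with $q$ elements. A polynomial $f \in \mathbb{F}_q[x]$ is called an exceptional polynomial over $\mathbb{F}_q$ if the map $c \mapsto f(c)$ is a bijection of $\mathbb{F}_{q^n}$ onto itself for infinitely many positive integers $n$ (i.e. $f$ is a permutation polynomial of infinitely many finite extensions of $\mathbb{F}_q$). *)

theory Defs
  imports "HOL-Computational_Algebra.Polynomial" "HOL-Algebra.Algebraic_Closure_Type"
begin

text \<open>The finite field F_{q^n}, realised inside the algebraic closure of F_q = 'a,
  as the set of roots of X^(q^n) - X, where q = CARD('a).\<close>
definition ff_ext :: "nat \<Rightarrow> ('a::{field,finite}) alg_closure set" where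
  "ff_ext n = {x. x ^ (card (UNIV :: 'a set) ^ n) = x}"

definition exceptional :: "('a::{field,finite}) poly \<Rightarrow> bool" where
  "exceptional f \<longleftrightarrow>
     infinite {n::nat. n \<ge> 1 \<and>
       bij_betw (\<lambda>c. poly (map_poly to_ac f) c) (ff_ext n :: 'a alg_closure set) (ff_ext n)}"

end

theory Submission
  imports Defs
begin

text \<open>
  Let \<open>Q = q^n\<close> and suppose that f is separable and permutes the field of order Q. Pushing
  \<open>dx / (x^Q - x)\<close> forward along \<open>t = f(x)\<close> gives \<open>dt / (t^Q - t)\<close>, that is, the sum of
  \<open>(f(r^Q) - f(r)) / ((r^Q - r) f'(r))\<close> over the roots r of \<open>f(X) = t\<close> is 1. The left hand side has
  the form \<open>\<Sum>j. b j * y j ^ Q\<close> with b and y independent of Q. Over an unramified point the roots are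
  power series in \<open>t - t0\<close>; if the relation holds for infinitely many n, then working modulo
  \<open>(t - t0)^Q\<close> one may replace the Q-th power in it by any homomorphism acting on the constants as a
  suitable power of Frobenius. For a homomorphism \<open>\<sigma>\<close> that fixes t the sum then counts, modulo the
  characteristic, the roots fixed by \<open>\<sigma>\<close>. So every such \<open>\<sigma>\<close> fixes a root.

  On the other hand let \<open>l > 1\<close> divide both the degree and q - 1. Near infinity, f is the l-th power of
  a Laurent series over the field of order q, so every root r generates an l-th root w of a multiple
  of t over the completion at infinity. Since the l-th roots of unity lie in the field of order q,
  some \<open>\<sigma>\<close> multiplies w by a nontrivial one, and this \<open>\<sigma>\<close> cannot fix any root.
\<close>

section \<open>Extending partial ring homomorphisms\<close>

text \<open>The relation holds near an unramified point \<open>t0\<close>, whereas the homomorphism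
  that moves every root lives over infinity. The two completions have to be bridged: the roots are
  algebraic over the rational functions in t, so a field homomorphism defined only on a subfield of
  the Laurent series at \<open>t0\<close> carries them into the algebraic closure of the Laurent
  series in z, where t = a / z^l. This is why homomorphisms are given by a domain and a function.
  The twist z -> \<zeta> z fixes z^l and, on constants, must act as the Frobenius power that the
  exponents n induce on finitely many power series coefficients. That finite set has to be known
  before the Frobenius power is chosen, and the infinitely many n are thinned out to one residue
  class accordingly. The contradiction needs no count: if a root and its image are distinct roots of
  f(X) = t, the difference quotient of f at the pair is zero, so every root contributes 0 to a sum
  equal to 1. An inseparable f is a p-th power, and p is coprime to l, so this case reduces to
  smaller degree.\<close>

definition subring_hom :: "'l::comm_ring_1 set \<Rightarrow> ('l \<Rightarrow> 'm::comm_ring_1) \<Rightarrow> bool" where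
  "subring_hom A h \<longleftrightarrow> 1 \<in> A \<and> h 1 = 1 \<and>
     (\<forall>x\<in>A. \<forall>y\<in>A. x - y \<in> A \<and> x * y \<in> A \<and> h (x - y) = h x - h y \<and> h (x * y) = h x * h y)"

definition subfield_hom :: "'l::field set \<Rightarrow> ('l \<Rightarrow> 'm::field) \<Rightarrow> bool" where
  "subfield_hom K h \<longleftrightarrow> subring_hom K h \<and> (\<forall>x\<in>K. inverse x \<in> K)"

definition polys_over :: "'l::zero set \<Rightarrow> 'l poly set" where
  "polys_over A = {p. \<forall>i. coeff p i \<in> A}"

lemma subring_homD:
  assumes "subring_hom A h"
  shows "1 \<in> A" "h 1 = 1"
    "x \<in> A \<Longrightarrow> y \<in> A \<Longrightarrow> x - y \<in> A" "x \<in> A \<Longrightarrow> y \<in> A \<Longrightarrow> x * y \<in> A"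
    "x \<in> A \<Longrightarrow> y \<in> A \<Longrightarrow> h (x - y) = h x - h y" "x \<in> A \<Longrightarrow> y \<in> A \<Longrightarrow> h (x * y) = h x * h y"
  using assms by (auto simp: subring_hom_def)

lemma subring_hom_0:
  assumes "subring_hom A h"
  shows "0 \<in> A" "h 0 = 0"
  using subring_homD(3,5)[OF assms subring_homD(1)[OF assms] subring_homD(1)[OF assms]] by simp_all

lemma subring_hom_uminus:
  assumes "subring_hom A h" "x \<in> A"
  shows "- x \<in> A" "h (- x) = - h x"
  using subring_homD(3,5)[OF assms(1) subring_hom_0(1)[OF assms(1)] assms(2)]
  by (simp_all add: subring_hom_0(2)[OF assms(1)])

lemma subring_hom_add:
  assumes "subring_hom A h" "x \<in> A" "y \<in> A"
  shows "x + y \<in> A" "h (x + y) = h x + h y"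
  using subring_homD(3,5)[OF assms(1,2) subring_hom_uminus(1)[OF assms(1,3)]]
  by (simp_all add: subring_hom_uminus(2)[OF assms(1,3)])

lemma subring_hom_power:
  assumes "subring_hom A h" "x \<in> A"
  shows "x ^ n \<in> A" "h (x ^ n) = h x ^ n"
proof -
  have "x ^ n \<in> A \<and> h (x ^ n) = h x ^ n"
    by (induction n) (auto simp: subring_homD[OF assms(1)] assms(2))
  then show "x ^ n \<in> A" "h (x ^ n) = h x ^ n" by auto
qed

lemma subring_hom_sum:
  assumes "subring_hom A h" "\<And>i. i \<in> I \<Longrightarrow> g i \<in> A"
  shows "sum g I \<in> A" "h (sum g I) = (\<Sum>i\<in>I. h (g i))"
proof -
  have "sum g I \<in> A \<and> h (sum g I) = (\<Sum>i\<in>I. h (g i))"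
    using assms(2)
    by (induction I rule: infinite_finite_induct)
      (auto simp: subring_hom_add[OF assms(1)] subring_hom_0[OF assms(1)])
  then show "sum g I \<in> A" "h (sum g I) = (\<Sum>i\<in>I. h (g i))" by auto
qed

lemma subfield_hom_inverse:
  assumes "subfield_hom K h" "x \<in> K"
  shows "inverse x \<in> K" "h (inverse x) = inverse (h x)"
proof -
  have r: "subring_hom K h" and i: "inverse x \<in> K" using assms by (auto simp: subfield_hom_def)
  show "inverse x \<in> K" by fact
  show "h (inverse x) = inverse (h x)"
  proof (cases "x = 0")
    case True then show ?thesis using subring_hom_0[OF r] by simp
  next
    case False
    then have "h x * h (inverse x) = 1"
      using subring_homD(2,6)[OF r] assms(2) i by (metis right_inverse)
    then show ?thesis by (metis inverse_unique)
  qed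
qed

lemma subfield_hom_divide:
  assumes "subfield_hom K h" "x \<in> K" "y \<in> K"
  shows "x / y \<in> K" "h (x / y) = h x / h y"
proof -
  have r: "subring_hom K h" using assms by (auto simp: subfield_hom_def)
  show "x / y \<in> K" "h (x / y) = h x / h y"
    using subfield_hom_inverse[OF assms(1,3)] subring_homD(4,6)[OF r assms(2)]
    by (simp_all add: divide_inverse)
qed

lemma subfield_hom_eq_0_iff:
  assumes "subfield_hom K h" "x \<in> K"
  shows "h x = 0 \<longleftrightarrow> x = 0"
proof
  assume "h x = 0"
  show "x = 0"
  proof (rule ccontr)
    assume "x \<noteq> 0"
    have r: "subring_hom K h" using assms by (auto simp: subfield_hom_def)
    have "h (x * inverse x) = h x * h (inverse x)"
      using subring_homD(6)[OF r assms(2)] subfield_hom_inverse(1)[OF assms] by blast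
    then show False using \<open>x \<noteq> 0\<close> \<open>h x = 0\<close> subring_homD(2)[OF r] by simp
  qed
next
  assume "x = 0" then show "h x = 0"
    using assms subring_hom_0 by (auto simp: subfield_hom_def)
qed

lemma subring_hom_inj:
  fixes h :: "'l::field \<Rightarrow> 'm::field"
  assumes h: "subring_hom UNIV h"
  shows "inj h"
proof (rule injI)
  fix x y assume "h x = h y"
  then have "h (x - y) = 0" using subring_homD(5)[OF h, of x y] by simp
  moreover have "subfield_hom UNIV h" using h by (simp add: subfield_hom_def)
  ultimately show "x = y" using subfield_hom_eq_0_iff[of UNIV h "x - y"] by simp
qed

lemma subring_hom_poly:
  assumes h: "subring_hom A h" and p: "p \<in> polys_over A" and x: "x \<in> A"
  shows "poly p x \<in> A" "h (poly p x) = poly (map_poly h p) (h x)"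
proof -
  have "poly p x \<in> A \<and> h (poly p x) = poly (map_poly h p) (h x)"
    using p
  proof (induction p)
    case 0 then show ?case using subring_hom_0[OF h] by simp
  next
    case (pCons a p)
    have "a \<in> A" using pCons.prems by (auto simp: polys_over_def dest: spec[of _ 0])
    moreover have "p \<in> polys_over A"
      using pCons.prems by (auto simp: polys_over_def dest: spec[of _ "Suc _"])
    ultimately show ?case using pCons.IH x
      by (simp add: map_poly_pCons subring_hom_0[OF h] subring_hom_add[OF h] subring_homD[OF h])
  qed
  then show "poly p x \<in> A" "h (poly p x) = poly (map_poly h p) (h x)" by auto
qed

lemma polys_over_closed:
  assumes "subring_hom A h"
  shows "p \<in> polys_over A \<Longrightarrow> q \<in> polys_over A \<Longrightarrow> p - q \<in> polys_over A"
    "p \<in> polys_over A \<Longrightarrow> q \<in> polys_over A \<Longrightarrow> p + q \<in> polys_over A"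
    "p \<in> polys_over A \<Longrightarrow> q \<in> polys_over A \<Longrightarrow> p * q \<in> polys_over A"
    "c \<in> A \<Longrightarrow> p \<in> polys_over A \<Longrightarrow> smult c p \<in> polys_over A"
    "c \<in> A \<Longrightarrow> monom c n \<in> polys_over A"
    "c \<in> A \<Longrightarrow> [:c:] \<in> polys_over A"
    "0 \<in> polys_over A" "1 \<in> polys_over A"
  using subring_hom_0(1)[OF assms] subring_homD(1)[OF assms]
  by (auto simp: polys_over_def coeff_mult coeff_pCons coeff_1
      intro!: subring_hom_sum(1)[OF assms]  subring_homD(3,4)[OF assms] subring_hom_add(1)[OF assms]
      split: nat.splits)

lemma map_poly_hom:
  assumes "subring_hom A h"
  shows "p \<in> polys_over A \<Longrightarrow> q \<in> polys_over A \<Longrightarrow> map_poly h (p - q) = map_poly h p - map_poly h q"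
    "p \<in> polys_over A \<Longrightarrow> q \<in> polys_over A \<Longrightarrow> map_poly h (p + q) = map_poly h p + map_poly h q"
    "p \<in> polys_over A \<Longrightarrow> q \<in> polys_over A \<Longrightarrow> map_poly h (p * q) = map_poly h p * map_poly h q"
  by (auto intro!: poly_eqI simp: coeff_map_poly subring_hom_0[OF assms] polys_over_def coeff_mult
      subring_homD[OF assms] subring_hom_add[OF assms] subring_hom_sum[OF assms])

lemma polys_over_division:
  assumes h: "subfield_hom K h" and q: "q \<in> polys_over K" "q \<noteq> 0" and p: "p \<in> polys_over K"
  shows "\<exists>s r. s \<in> polys_over K \<and> r \<in> polys_over K \<and> p = q * s + r \<and> (r = 0 \<or> degree r < degree q)"
  using p
proof (induction "degree p" arbitrary: p rule: less_induct)
  case less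
  have r: "subring_hom K h" using h by (auto simp: subfield_hom_def)
  note cl = polys_over_closed[OF r]
  show ?case
  proof (cases "p = 0 \<or> degree p < degree q")
    case True
    then show ?thesis using less.prems by (intro exI[of _ 0] exI[of _ p]) (auto simp: cl)
  next
    case False
    then have deg: "degree q \<le> degree p" "p \<noteq> 0" by auto
    define c where "c = lead_coeff p / lead_coeff q"
    define m where "m = monom c (degree p - degree q)"
    have "c \<in> K" using less.prems q subfield_hom_divide(1)[OF h] by (auto simp: c_def polys_over_def)
    have mK: "m \<in> polys_over K" by (simp add: m_def cl \<open>c \<in> K\<close>)
    have "c \<noteq> 0" using deg q by (auto simp: c_def)
    define p' where "p' = p - q * m"
    have p'K: "p' \<in> polys_over K" using less.prems mK q by (simp add: p'_def cl)
    have dqm: "degree (q * m) = degree p"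
      using deg q \<open>c \<noteq> 0\<close> by (subst degree_mult_eq) (auto simp: m_def degree_monom_eq)
    have "coeff (q * m) (degree p) = lead_coeff p"
    proof -
      have "coeff (q * m) (degree p) = lead_coeff (q * m)" by (simp add: dqm)
      also have "\<dots> = lead_coeff q * c"
        by (subst lead_coeff_mult) (auto simp: m_def \<open>c \<noteq> 0\<close> degree_monom_eq)
      finally show ?thesis using q by (simp add: c_def)
    qed
    then have c0: "coeff p' (degree p) = 0" by (simp add: p'_def)
    have "degree p' \<le> degree p" unfolding p'_def by (rule degree_diff_le) (auto simp: dqm)
    show ?thesis
    proof (cases "p' = 0")
      case True
      then show ?thesis using mK by (intro exI[of _ m] exI[of _ 0]) (auto simp: p'_def cl)
    next
      case False
      then have "degree p' < degree p"
        using c0 \<open>degree p' \<le> degree p\<close> by (metis le_neq_implies_less leading_coeff_0_iff)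
      from less.hyps[OF this p'K] obtain s r' where
        "s \<in> polys_over K" "r' \<in> polys_over K" "p' = q * s + r'" "r' = 0 \<or> degree r' < degree q"
        by blast
      then show ?thesis using mK
        by (intro exI[of _ "m + s"] exI[of _ r']) (auto simp: p'_def cl algebra_simps)
    qed
  qed
qed

text \<open>Cross multiplication a d = c b survives \<open>h\<close>, and injectivity keeps the
  denominators nonzero, so sending a / b to h a / h b is well defined.\<close>

lemma subring_hom_extend_fractions:
  fixes h :: "'l::field \<Rightarrow> 'm::field"
  assumes h: "subring_hom A h" and inj: "\<And>x. x \<in> A \<Longrightarrow> h x = 0 \<Longrightarrow> x = 0"
  shows "\<exists>h'. subfield_hom {a / b | a b. a \<in> A \<and> b \<in> A} h' \<and> (\<forall>a\<in>A. h' a = h a)"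
proof -
  define K where "K = {a / b | a b. a \<in> A \<and> b \<in> A}"
  define P where "P x z \<longleftrightarrow> (\<exists>a b. a \<in> A \<and> b \<in> A \<and> b \<noteq> 0 \<and> x = a / b \<and> z = h a / h b)" for x z
  define h' where "h' x = (THE z. P x z)" for x
  note hD = subring_homD[OF h]
  have uniq: "z = z'" if P1: "P x z" and P2: "P x z'" for x z z'
  proof -
    obtain a b where ab: "a \<in> A" "b \<in> A" "b \<noteq> 0" "x = a / b" "z = h a / h b"
      using P1 unfolding P_def by blast
    obtain c d where cd: "c \<in> A" "d \<in> A" "d \<noteq> 0" "x = c / d" "z' = h c / h d"
      using P2 unfolding P_def by blast
    have "a * d = c * b" using ab cd by (simp add: frac_eq_eq)
    then have "h a * h d = h c * h b" using hD(6) ab cd by metis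
    then show ?thesis using ab cd inj by (simp add: frac_eq_eq) (metis frac_eq_eq inj)
  qed
  have h'I: "h' x = z" if "P x z" for x z unfolding h'_def using that uniq by blast
  have h'q: "h' (a / b) = h a / h b" if "a \<in> A" "b \<in> A" "b \<noteq> 0" for a b
    by (rule h'I) (use that P_def in blast)
  have ext: "h' a = h a" if "a \<in> A" for a using h'q[OF that hD(1)] hD(2) by simp
  \<comment> \<open>The set of fractions allows \<open>b = 0\<close>, where division yields 0; such
    an element is rewritten as 0 / 1.\<close>
  have KE: "\<exists>a b. a \<in> A \<and> b \<in> A \<and> b \<noteq> 0 \<and> x = a / b" if xK: "x \<in> K" for x
  proof -
    obtain a b where ab: "a \<in> A" "b \<in> A" "x = a / b" using xK unfolding K_def by blast
    show ?thesis
    proof (cases "b = 0")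
      case True then have "x = 0 / 1" using ab by simp
      then show ?thesis using hD(1) subring_hom_0[OF h] by (metis zero_neq_one)
    qed (use ab in blast)
  qed
  have KI: "a / b \<in> K" if "a \<in> A" "b \<in> A" for a b using that K_def by auto
  have "subring_hom K h'"
    unfolding subring_hom_def
  proof (intro conjI ballI)
    show "1 \<in> K" using KI[OF hD(1) hD(1)] by simp
    show "h' 1 = 1" using ext hD by simp
    fix x y assume "x \<in> K" "y \<in> K"
    obtain a b where ab: "a \<in> A" "b \<in> A" "b \<noteq> 0" "x = a / b" using KE \<open>x \<in> K\<close> by blast
    obtain c d where cd: "c \<in> A" "d \<in> A" "d \<noteq> 0" "y = c / d" using KE \<open>y \<in> K\<close> by blast
    have hb: "h b \<noteq> 0" "h d \<noteq> 0" using inj ab cd by auto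
    have e1: "x - y = (a * d - c * b) / (b * d)" using ab cd by (simp add: diff_frac_eq)
    have e2: "x * y = (a * c) / (b * d)" using ab cd by simp
    have m: "a * d - c * b \<in> A" "b * d \<in> A" "a * c \<in> A" "b * d \<noteq> 0" "a * d \<in> A" "c * b \<in> A" using ab cd hD by auto
    show "x - y \<in> K" unfolding e1 by (rule KI; fact)
    show "x * y \<in> K" unfolding e2 by (rule KI; fact)
    have "h' (x - y) = (h a * h d - h c * h b) / (h b * h d)"
      unfolding e1 using h'q[OF m(1,2,4)] hD m ab cd by simp
    then show "h' (x - y) = h' x - h' y"
      using h'q ab cd hb by (simp add: diff_frac_eq)
    have "h' (x * y) = (h a * h c) / (h b * h d)"
      unfolding e2 using h'q[OF m(3,2,4)] hD m ab cd by simp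
    then show "h' (x * y) = h' x * h' y"
      using h'q ab cd hb by simp
  qed
  moreover have "inverse x \<in> K" if "x \<in> K" for x
    using KE[OF that] KI by (metis inverse_divide)
  ultimately show ?thesis using ext unfolding subfield_hom_def K_def by blast
qed

text \<open>Let \<open>m\<close> have least degree among the nonzero polynomials over
  \<open>K\<close> that vanish at \<open>x\<close>. Its image under \<open>h\<close> has a root
  \<open>y\<close> because the target is algebraically closed, and sending \<open>x\<close> to
  \<open>y\<close> is consistent since \<open>m\<close> divides every polynomial over
  \<open>K\<close> vanishing at \<open>x\<close>.\<close>

lemma subfield_hom_extend_algebraic:
  fixes h :: "'l::field \<Rightarrow> 'm::alg_closed_field"
  assumes h: "subfield_hom K h" and p: "p \<in> polys_over K" "p \<noteq> 0" "poly p x = 0"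
  shows "\<exists>K' h'. subfield_hom K' h' \<and> K \<subseteq> K' \<and> x \<in> K' \<and> (\<forall>a\<in>K. h' a = h a)"
proof -
  have r: "subring_hom K h" using h by (auto simp: subfield_hom_def)
  note cl = polys_over_closed[OF r]
  define Q where "Q p \<longleftrightarrow> p \<in> polys_over K \<and> p \<noteq> 0 \<and> poly p x = 0" for p
  define m where "m = arg_min degree Q"
  have min: "degree m \<le> degree u" if "Q u" for u
    using that arg_min_nat_le[of Q _ degree] by (auto simp: m_def)
  have "Q m" using arg_min_natI[of Q p degree] p by (auto simp: m_def Q_def)
  then have m: "m \<in> polys_over K" "m \<noteq> 0" "poly m x = 0" by (auto simp: Q_def)
  have "degree m \<noteq> 0"
  proof
    assume "degree m = 0" then obtain c where "m = [:c:]" by (meson degree_eq_zeroE)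
    then show False using m by simp
  qed
  have "degree (map_poly h m) = degree m"
    by (rule map_poly_degree_eq) (use m subfield_hom_eq_0_iff[OF h] in \<open>auto simp: polys_over_def\<close>)
  then obtain y where y: "poly (map_poly h m) y = 0"
    using alg_closed_imp_poly_has_root[of "map_poly h m"] \<open>degree m \<noteq> 0\<close> by auto
  have vanish: "poly (map_poly h p) y = 0" if pp: "p \<in> polys_over K" "poly p x = 0" for p
  proof -
    obtain s u where su: "s \<in> polys_over K" "u \<in> polys_over K" "p = m * s + u" "u = 0 \<or> degree u < degree m"
      using polys_over_division[OF h m(1,2) pp(1)] by blast
    have "poly u x = 0" using pp su m by simp
    then have "u = 0" using su(2,4) min[of u] unfolding Q_def by linarith
    then have "map_poly h p = map_poly h m * map_poly h s" using map_poly_hom(3)[OF r m(1) su(1)] su by simp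
    then show ?thesis using y by simp
  qed
  define K' where "K' = (\<lambda>p. poly p x) ` polys_over K"
  \<comment> \<open>The representing polynomial is picked by choice; \<open>vanish\<close>, applied
    to a difference of two representatives, shows that the value does not depend on the
    pick.\<close>
  define h' where "h' z = poly (map_poly h (SOME p. p \<in> polys_over K \<and> poly p x = z)) y" for z
  have h'q: "h' (poly p x) = poly (map_poly h p) y" if pp: "p \<in> polys_over K" for p
  proof -
    define p' where "p' = (SOME p'. p' \<in> polys_over K \<and> poly p' x = poly p x)"
    have p': "p' \<in> polys_over K" "poly p' x = poly p x"
      using someI[of "\<lambda>p'. p' \<in> polys_over K \<and> poly p' x = poly p x" p] pp by (auto simp: p'_def)
    have "poly (map_poly h (p' - p)) y = 0" by (rule vanish) (use p' pp cl in auto)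
    then show ?thesis using map_poly_hom(1)[OF r p'(1) pp] by (simp add: h'_def p'_def)
  qed
  have ext: "a \<in> K' \<and> h' a = h a" if "a \<in> K" for a
    using h'q[of "[:a:]"] cl(6)[OF that] subring_hom_0[OF r]
    by (auto simp: K'_def map_poly_pCons intro!: image_eqI[of _ _ "[:a:]"])
  have "[:0, 1:] \<in> polys_over K"
    using subring_hom_0[OF r] subring_homD(1)[OF r]
    by (auto simp: polys_over_def coeff_pCons split: nat.splits)
  then have "x \<in> K'" by (auto simp: K'_def intro!: image_eqI[of _ _ "[:0, 1:]"])
  have "subring_hom K' h'"
    unfolding subring_hom_def
  proof (intro conjI ballI)
    show "1 \<in> K'" "h' 1 = 1" using ext subring_homD(1,2)[OF r] by auto
    fix a b assume "a \<in> K'" "b \<in> K'"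
    then obtain p q where pq: "p \<in> polys_over K" "q \<in> polys_over K" "a = poly p x" "b = poly q x"
      by (auto simp: K'_def)
    have e: "a - b = poly (p - q) x" "a * b = poly (p * q) x" using pq by auto
    show "a - b \<in> K'" "a * b \<in> K'" unfolding e K'_def by (intro imageI cl pq)+
    show "h' (a - b) = h' a - h' b" "h' (a * b) = h' a * h' b"
      unfolding e unfolding pq(3,4)
      using h'q[OF cl(1)[OF pq(1,2)]] h'q[OF cl(3)[OF pq(1,2)]] h'q[OF pq(1)] h'q[OF pq(2)]
      by (simp_all only: map_poly_hom(1,3)[OF r pq(1,2)] poly_diff poly_mult)
  qed
  \<comment> \<open>Dividing \<open>m\<close> by \<open>p\<close> leaves a remainder u of smaller
    degree with u(x) = - p(x) s(x), so an inverse of u(x) yields one of p(x). Minimality of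
    \<open>m\<close> excludes u(x) = 0.\<close>
  moreover have inv: "\<exists>r\<in>polys_over K. poly p x * poly r x = 1"
    if "p \<in> polys_over K" "poly p x \<noteq> 0" "degree p < degree m" for p
    using that
  proof (induction "degree p" arbitrary: p rule: less_induct)
    case less
    have "p \<noteq> 0" using less.prems by auto
    show ?case
    proof (cases "degree p = 0")
      case True
      then obtain c where c: "p = [:c:]" by (meson degree_eq_zeroE)
      then have "c \<in> K" "c \<noteq> 0" using less.prems by (auto simp: polys_over_def dest: spec[of _ 0])
      then show ?thesis using c cl subfield_hom_inverse(1)[OF h] by (intro bexI[of _ "[:inverse c:]"]) auto
    next
      case False
      obtain s u where su: "s \<in> polys_over K" "u \<in> polys_over K" "m = p * s + u" "u = 0 \<or> degree u < degree p"
        using polys_over_division[OF h less.prems(1) \<open>p \<noteq> 0\<close> m(1)] by blast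
      have eq: "poly u x = - poly p x * poly s x"
        using m(3) su(3) by (simp add: eq_neg_iff_add_eq_0 add.commute)
      have "poly u x \<noteq> 0"
      proof
        assume "poly u x = 0"
        then have "u = 0" using su(2,4) less.prems(3) min[of u] unfolding Q_def by linarith
        then have "m = p * s" using su by simp
        have "s \<noteq> 0" using \<open>m = p * s\<close> m(2) by auto
        have "poly s x = 0" using eq \<open>poly u x = 0\<close> less.prems by auto
        then have "degree m \<le> degree s" using min[of s] su \<open>s \<noteq> 0\<close> by (auto simp: Q_def)
        moreover have "degree m = degree p + degree s"
          unfolding \<open>m = p * s\<close> using \<open>s \<noteq> 0\<close> \<open>p \<noteq> 0\<close> by (simp add: degree_mult_eq)
        ultimately show False using False by simp
      qed
      moreover have "degree u < degree p" using su False \<open>poly u x \<noteq> 0\<close> by auto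
      ultimately obtain w where "w \<in> polys_over K" "poly u x * poly w x = 1"
        using less.hyps[of u] su less.prems by auto
      then show ?thesis using eq su cl(3)[of s w] cl(1)[OF cl(7), of "s * w"]
        by (intro bexI[of _ "0 - s * w"]) (auto simp: mult.assoc)
    qed
  qed
  have "inverse a \<in> K'" if aK: "a \<in> K'" for a
  proof (cases "a = 0")
    case True then show ?thesis using aK by simp
  next
    case False
    obtain p where p: "p \<in> polys_over K" "a = poly p x" using aK by (auto simp: K'_def)
    obtain s u where su: "s \<in> polys_over K" "u \<in> polys_over K" "p = m * s + u" "u = 0 \<or> degree u < degree m"
      using polys_over_division[OF h m(1,2) p(1)] by blast
    have "a = poly u x" using p su m by simp
    then have "degree u < degree m" using False su by auto
    from inv[OF su(2) _ this] obtain w where "w \<in> polys_over K" "a * poly w x = 1"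
      using False \<open>a = poly u x\<close> by auto
    then have "inverse a = poly w x" by (metis inverse_unique)
    then show ?thesis using \<open>w \<in> polys_over K\<close> by (auto simp: K'_def)
  qed
  ultimately have "subfield_hom K' h'" by (auto simp: subfield_hom_def)
  then show ?thesis using ext \<open>x \<in> K'\<close> by blast
qed

lemma subfield_hom_extend_finite:
  fixes h :: "'l::field \<Rightarrow> 'm::alg_closed_field"
  assumes "subfield_hom K h" "finite S"
    and "\<And>x. x \<in> S \<Longrightarrow> \<exists>p\<in>polys_over K. p \<noteq> 0 \<and> poly p x = 0"
  shows "\<exists>K' h'. subfield_hom K' h' \<and> K \<subseteq> K' \<and> S \<subseteq> K' \<and> (\<forall>a\<in>K. h' a = h a)"
  using assms(2,3)
proof (induction S)
  case empty then show ?case using assms(1) by blast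
next
  case (insert x S)
  then obtain K1 h1 where 1: "subfield_hom K1 h1" "K \<subseteq> K1" "S \<subseteq> K1" "\<forall>a\<in>K. h1 a = h a" by auto
  obtain p where p: "p \<in> polys_over K" "p \<noteq> 0" "poly p x = 0" using insert.prems[of x] by auto
  then have "p \<in> polys_over K1" using 1 by (auto simp: polys_over_def)
  from subfield_hom_extend_algebraic[OF 1(1) this p(2,3)] obtain K2 h2 where
    "subfield_hom K2 h2" "K1 \<subseteq> K2" "x \<in> K2" "\<forall>a\<in>K1. h2 a = h1 a" by blast
  then show ?case using 1 by (intro exI[of _ K2] exI[of _ h2]) auto
qed

section \<open>Frobenius-twisted linear relations between power series\<close>

text \<open>The set M of coefficient positions depends only on the y j: the elimination pivots never
  look at the relation coefficients.\<close>

lemma linear_relation_from_coeffs: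
  fixes y :: "'j \<Rightarrow> 'k::field fps"
  assumes "finite J"
  shows "\<exists>M. finite M \<and> (\<forall>A h. \<forall>b :: 'j \<Rightarrow> 'm::field. subring_hom A h \<longrightarrow> range fps_const \<subseteq> A \<longrightarrow> y ` J \<subseteq> A \<longrightarrow>
     (\<forall>m\<in>M. (\<Sum>j\<in>J. b j * h (fps_const (y j $ m))) = 0) \<longrightarrow> (\<Sum>j\<in>J. b j * h (y j)) = 0)"
  using assms
proof (induction "card J" arbitrary: J y)
  case 0
  then show ?case by (intro exI[of _ "{}"]) auto
next
  case (Suc n)
  show ?case
  proof (cases "\<forall>j\<in>J. y j = 0")
    case True
    have nz: "h (y j) = 0" if "subring_hom A h" "j \<in> J" for A and h :: "'k fps \<Rightarrow> 'm" and j
      using True that subring_hom_0(2) by metis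
    have "(\<Sum>j\<in>J. b j * h (y j)) = 0" if "subring_hom A h" for A h and b :: "'j \<Rightarrow> 'm"
      by (rule sum.neutral) (simp add: nz[OF that])
    then show ?thesis by (intro exI[of _ "{}"] conjI allI impI finite.emptyI)
  next
    case False
    then obtain i m where i: "i \<in> J" and im: "y i $ m \<noteq> 0" by (auto simp: fps_eq_iff)
    \<comment> \<open>Pivot: subtracting \<open>c j\<close> times \<open>y i\<close> clears
      coefficient \<open>m\<close> of \<open>y j\<close>.\<close>
    define c where "c j = y j $ m / y i $ m" for j
    define z where "z j = y j - fps_const (c j) * y i" for j
    have "n = card (J - {i})" "finite (J - {i})" using Suc.hyps(2) Suc.prems i by auto
    from Suc.hyps(1)[OF this, of z] obtain M where M: "finite M"
      and z: "\<And>A h b. subring_hom A h \<Longrightarrow> range fps_const \<subseteq> A \<Longrightarrow> z ` (J - {i}) \<subseteq> A \<Longrightarrow>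
        (\<forall>m\<in>M. (\<Sum>j\<in>J - {i}. (b j :: 'm) * h (fps_const (z j $ m))) = 0) \<Longrightarrow> (\<Sum>j\<in>J - {i}. b j * h (z j)) = 0"
      by blast
    have "(\<Sum>j\<in>J. b j * h (y j)) = 0"
      if h: "subring_hom A h" and cA: "range fps_const \<subseteq> A" and yA: "y ` J \<subseteq> A"
        and rel: "\<forall>m\<in>insert m M. (\<Sum>j\<in>J. b j * h (fps_const (y j $ m))) = 0"
      for A h and b :: "'j \<Rightarrow> 'm"
    proof -
      define g where "g a = h (fps_const a)" for a
      have gm: "g (x * w) = g x * g w" for x w
        using subring_homD(6)[OF h, of "fps_const x" "fps_const w"] cA by (auto simp: g_def)
      have gd: "g (x - w) = g x - g w" for x w
        using subring_homD(5)[OF h, of "fps_const x" "fps_const w"] cA by (auto simp: g_def)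
      have "g 1 = 1" using subring_homD(2)[OF h] by (simp add: g_def)
      then have "g (y i $ m) \<noteq> 0" using gm[of "y i $ m" "inverse (y i $ m)"] im by auto
      have gy: "g (y j $ m) = g (c j) * g (y i $ m)" if "j \<noteq> i" for j using im by (simp add: c_def flip: gm)
      have splitJ: "(\<Sum>j\<in>J. f j) = f i + (\<Sum>j\<in>J - {i}. f j)" for f :: "'j \<Rightarrow> 'm"
        using i Suc.prems by (simp add: sum.remove)
      have "(\<Sum>j\<in>J. b j * g (y j $ m)) = 0" using rel by (simp add: g_def)
      then have "(b i + (\<Sum>j\<in>J - {i}. b j * g (c j))) * g (y i $ m) = 0"
        using sum.cong[OF refl, of "J - {i}" "\<lambda>j. b j * g (y j $ m)" "\<lambda>j. b j * (g (c j) * g (y i $ m))"]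
        by (simp add: splitJ gy distrib_right sum_distrib_right mult.assoc)
      \<comment> \<open>The relation at the pivot position expresses \<open>b i\<close> through the
        other coefficients, so the index \<open>i\<close> drops out and the induction applies to the
        \<open>z j\<close>.\<close>
      then have bi: "b i = - (\<Sum>j\<in>J - {i}. b j * g (c j))"
        using \<open>g (y i $ m) \<noteq> 0\<close> by (simp add: eq_neg_iff_add_eq_0)
      have elim: "(\<Sum>j\<in>J. b j * w j) = (\<Sum>j\<in>J - {i}. b j * (w j - g (c j) * w i))" for w
        by (simp add: splitJ bi algebra_simps sum_subtractf sum_distrib_left)
      have hz: "h (z j) = h (y j) - g (c j) * h (y i)" "z j \<in> A" if "j \<in> J" for j
        using subring_homD(3-6)[OF h] cA yA i that by (auto simp: z_def g_def image_subset_iff)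
      have gz: "g (z j $ m') = g (y j $ m') - g (c j) * g (y i $ m')" for j m'
        by (simp add: z_def gd gm)
      have "(\<Sum>j\<in>J - {i}. b j * h (z j)) = 0"
      proof (rule z[OF h cA])
        show "z ` (J - {i}) \<subseteq> A" using hz by auto
        show "\<forall>m\<in>M. (\<Sum>j\<in>J - {i}. b j * h (fps_const (z j $ m))) = 0"
        proof
          fix m' assume "m' \<in> M"
          then have "(\<Sum>j\<in>J. b j * g (y j $ m')) = 0" using rel by (simp add: g_def)
          then show "(\<Sum>j\<in>J - {i}. b j * h (fps_const (z j $ m'))) = 0"
            by (simp add: elim gz flip: g_def)
        qed
      qed
      then show ?thesis by (simp add: elim hz(1))
    qed
    then show ?thesis using M by (intro exI[of _ "insert m M"] conjI allI impI) simp_all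
  qed
qed

lemma fps_power_frobenius:
  fixes y :: "'k::field fps"
  assumes "prime CHAR('k)" "Q = CHAR('k) ^ k"
  shows "y ^ Q = fps_const ((y $ 0) ^ Q) + fps_X ^ Q * (fps_shift 1 y) ^ Q"
proof -
  have "y = fps_const (y $ 0) + fps_X * fps_shift 1 y"
    by (rule fps_ext) (auto simp: fps_X_mult_nth)
  then have "y ^ Q = (fps_const (y $ 0) + fps_X * fps_shift 1 y) ^ Q" by (rule arg_cong)
  also have "\<dots> = fps_const (y $ 0) ^ Q + (fps_X * fps_shift 1 y) ^ Q"
    by (rule freshmans_dream') (use assms in auto)
  finally show ?thesis by (simp add: power_mult_distrib fps_const_power)
qed

text \<open>Modulo \<open>X^Q\<close> only the constant terms of the y j contribute; by const they do so
  independently of n.\<close>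

lemma fps_frobenius_relation_step:
  fixes b y :: "'j \<Rightarrow> 'k::field fps"
  assumes p: "prime CHAR('k)" and Q: "\<And>n. n \<in> N \<Longrightarrow> \<exists>k. Q n = CHAR('k) ^ k" "inj_on Q N" and inf: "infinite N"
    and const: "\<And>j n. j \<in> J \<Longrightarrow> n \<in> N \<Longrightarrow> (y j $ 0) ^ Q n = g (y j $ 0)"
    and rel: "\<And>n. n \<in> N \<Longrightarrow> (\<Sum>j\<in>J. b j * y j ^ Q n) = 0"
  shows "(\<Sum>j\<in>J. b j * fps_const (g (y j $ 0))) = 0"
    and "n \<in> N \<Longrightarrow> (\<Sum>j\<in>J. b j * fps_shift 1 (y j) ^ Q n) = 0"
proof -
  define B where "B = (\<Sum>j\<in>J. b j * fps_const (g (y j $ 0)))"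
  define R where "R n = (\<Sum>j\<in>J. b j * (fps_shift 1 (y j)) ^ Q n)" for n
  have BR: "B + fps_X ^ Q n * R n = 0" if n: "n \<in> N" for n
  proof -
    obtain k where k: "Q n = CHAR('k) ^ k" using Q(1) n by blast
    have "(\<Sum>j\<in>J. b j * y j ^ Q n)
        = (\<Sum>j\<in>J. b j * fps_const (g (y j $ 0)) + fps_X ^ Q n * (b j * (fps_shift 1 (y j)) ^ Q n))"
    proof (rule sum.cong)
      fix j assume "j \<in> J"
      show "b j * y j ^ Q n = b j * fps_const (g (y j $ 0)) + fps_X ^ Q n * (b j * fps_shift 1 (y j) ^ Q n)"
        using fps_power_frobenius[OF p k, of "y j"] const[OF \<open>j \<in> J\<close> n] by (simp add: algebra_simps)
    qed simp
    also have "\<dots> = B + fps_X ^ Q n * R n"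
      by (simp only: sum.distrib B_def R_def sum_distrib_left)
    finally show ?thesis using rel n by simp
  qed
  have "B $ i = 0" for i
  proof -
    have "infinite (Q ` N)" using inf Q(2) by (simp add: finite_image_iff)
    \<comment> \<open>\<open>Q\<close> is unbounded on \<open>N\<close>, so position
      \<open>i\<close> lies below X^Q for some n, and there only \<open>B\<close>
      contributes.\<close>
    then obtain n where n: "n \<in> N" "Q n > i" unfolding infinite_nat_iff_unbounded by auto
    have "(B + fps_X ^ Q n * R n) $ i = 0" using BR[OF n(1)] by simp
    then show ?thesis using n(2) by (simp add: fps_X_power_mult_nth)
  qed
  then have "B = 0" by (simp add: fps_eq_iff)
  then show "(\<Sum>j\<in>J. b j * fps_const (g (y j $ 0))) = 0" by (simp only: B_def)
  show "(\<Sum>j\<in>J. b j * fps_shift 1 (y j) ^ Q n) = 0" if "n \<in> N"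
    using BR[OF that] \<open>B = 0\<close> by (simp add: R_def)
qed

text \<open>After the constant terms are removed, the shifted series satisfy the same relations, so
  coefficient \<open>m\<close> becomes a constant term after \<open>m\<close> shifts. Frobenius has
  to be controlled only up to position \<open>m\<close>, which keeps the set of coefficients
  involved finite.\<close>

lemma fps_frobenius_relation_coeffs:
  fixes b y :: "'j \<Rightarrow> 'k::field fps"
  assumes "prime CHAR('k)" "\<And>n. n \<in> N \<Longrightarrow> \<exists>k. Q n = CHAR('k) ^ k" "inj_on Q N" "infinite N"
    and "\<And>j i n. j \<in> J \<Longrightarrow> i \<le> m \<Longrightarrow> n \<in> N \<Longrightarrow> (y j $ i) ^ Q n = g (y j $ i)"
    and "\<And>n. n \<in> N \<Longrightarrow> (\<Sum>j\<in>J. b j * y j ^ Q n) = 0"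
  shows "(\<Sum>j\<in>J. b j * fps_const (g (y j $ m))) = 0"
  using assms(5,6)
proof (induction m arbitrary: y)
  case 0
  show ?case by (rule fps_frobenius_relation_step(1)[OF assms(1-4)]) (use 0 in auto)
next
  case (Suc m)
  have "(\<Sum>j\<in>J. b j * fps_const (g (fps_shift 1 (y j) $ m))) = 0"
  proof (rule Suc.IH)
    show "(fps_shift 1 (y j) $ i) ^ Q n = g (fps_shift 1 (y j) $ i)" if "j \<in> J" "i \<le> m" "n \<in> N" for j i n
      using Suc.prems(1)[of j "Suc i" n] that by simp
    show "(\<Sum>j\<in>J. b j * fps_shift 1 (y j) ^ Q n) = 0" if n: "n \<in> N" for n
      by (rule fps_frobenius_relation_step(2)[OF assms(1-4) _ _ n, where g = g]) (use Suc.prems in auto)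
  qed
  then show ?case by simp
qed

section \<open>An \<open>\<ell>\<close>-th root of the parameter at infinity\<close>

lemma subring_homI:
  assumes "h 1 = 1" "\<And>x y. h (x - y) = h x - h y" "\<And>x y. h (x * y) = h x * h y"
  shows "subring_hom UNIV h"
  using assms by (simp add: subring_hom_def)

lemma polys_over_UNIV [simp]: "p \<in> polys_over UNIV"
  by (simp add: polys_over_def)

text \<open>The series (1 + X)^l - 1 has linear coefficient l, which is invertible, so it has a
  compositional inverse B. Then (1 + B)^l = 1 + X, and substituting h - 1 for X gives the
  root.\<close>

lemma fps_root_exists:
  fixes h :: "'k::field fps"
  assumes h: "h $ 0 = 1" and l: "of_nat l \<noteq> (0 :: 'k)"
  shows "\<exists>g. g ^ l = h"
proof -
  define A where "A = (1 + fps_X :: 'k fps) ^ l - 1"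
  have "((1 + fps_X :: 'k fps) ^ l) $ 0 = 1" by (induction l) auto
  then have A0: "A $ 0 = 0" by (simp add: A_def)
  have "((1 + fps_X :: 'k fps) ^ l) $ 1 = of_nat l"
    by (induction l) (auto simp: fps_mult_nth_1 fps_power_zeroth)
  then have A1: "A $ 1 \<noteq> 0" using l by (simp add: A_def)
  define B where "B = fps_inv A"
  have B0: "B $ 0 = 0" by (simp add: B_def fps_inv_def)
  have AB: "A oo B = fps_X" unfolding B_def by (rule fps_inv_right[OF A0 A1])
  have "A oo B = (1 + B) ^ l - 1"
    by (simp add: A_def fps_compose_sub_distrib fps_compose_add_distrib B0 flip: fps_compose_power)
  then have r: "(1 + B) ^ l = 1 + fps_X" using AB by (simp add: algebra_simps)
  have h0: "(h - 1) $ 0 = 0" using h by simp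
  have "((1 + B) oo (h - 1)) ^ l = (1 + fps_X) oo (h - 1)"
    unfolding r[symmetric] by (rule fps_compose_power[OF h0])
  also have "\<dots> = h" by (simp add: fps_compose_add_distrib fps_X_fps_compose_startby0[OF h0])
  finally show ?thesis by blast
qed

text \<open>Here \<tau> is X^d times a unit. The context shows that the power series in X form a
  free module with basis 1, X, ..., X^(d-1) over the power series in \<tau>.\<close>

context
  fixes F \<tau> :: "'k::field fps" and d :: nat
  assumes d: "d > 0" and F0: "F $ 0 \<noteq> 0" and \<tau>F: "\<tau> * F = fps_X ^ d"
begin

lemma tau_nth_0: "\<tau> $ 0 = 0"
proof -
  have "\<tau> $ 0 * F $ 0 = 0" using \<tau>F d by (metis fps_mult_nth_0 fps_X_power_nth less_numeral_extra(3))
  then show ?thesis using F0 by simp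
qed

lemma subdegree_tau: "subdegree \<tau> = d"
proof -
  have "\<tau> \<noteq> 0" "F \<noteq> 0" using \<tau>F F0 by auto
  then have "subdegree (\<tau> * F) = subdegree \<tau> + subdegree F" by simp
  then show ?thesis using \<tau>F F0 by simp
qed

text \<open>Splitting off the terms below X^d and writing X^d as \<tau> * F amounts to repeated
  division by \<tau>: \<open>G m\<close> is the m-th quotient, and \<open>v j\<close> collects the
  coefficients of X^j. What is left over is divisible by every power of \<tau>, hence zero.\<close>

lemma weierstrass_expansion: "\<exists>v. g = (\<Sum>j<d. fps_X ^ j * (v j oo \<tau>))"
proof -
  define G where "G = rec_nat g (\<lambda>_ u. F * fps_shift d u)"
  have G0: "G 0 = g" and GS: "\<And>m. G (Suc m) = F * fps_shift d (G m)" by (simp_all add: G_def)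
  define v where "v j = Abs_fps (\<lambda>m. G m $ j)" for j
  define D where "D m = G m - (\<Sum>j<d. fps_X ^ j * (fps_shift m (v j) oo \<tau>))" for m
  have step: "D m = \<tau> * D (Suc m)" for m
  proof -
    have "G m = fps_cutoff d (G m) + fps_shift d (G m) * fps_X ^ d"
      by (rule fps_ext) (simp add: fps_X_power_mult_right_nth)
    also have "fps_cutoff d (G m) = (\<Sum>j<d. fps_const (v j $ m) * fps_X ^ j)"
      by (rule fps_ext) (auto simp: fps_sum_nth v_def fps_X_power_nth if_distrib cong: if_cong)
    also have "fps_shift d (G m) * fps_X ^ d = \<tau> * G (Suc m)"
      by (simp add: GS mult_ac flip: \<tau>F)
    finally have 1: "G m = (\<Sum>j<d. fps_const (v j $ m) * fps_X ^ j) + \<tau> * G (Suc m)" .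
    have 2: "fps_shift m (v j) oo \<tau> = fps_const (v j $ m) + \<tau> * (fps_shift (Suc m) (v j) oo \<tau>)" for j
    proof -
      have "fps_shift m (v j) = fps_const (v j $ m) + fps_X * fps_shift (Suc m) (v j)"
        by (rule fps_ext) (auto simp: fps_X_mult_nth)
      then show ?thesis
        by (simp add: fps_compose_add_distrib fps_compose_mult_distrib[OF tau_nth_0] tau_nth_0)
    qed
    show ?thesis unfolding D_def 2
      by (subst 1) (simp add: algebra_simps sum.distrib sum_distrib_left)
  qed
  have "D 0 = \<tau> ^ m * D m" for m
    by (induction m) (simp_all add: step[symmetric] mult.assoc power_Suc2 del: power_Suc)
  have "D 0 $ i = 0" for i
  proof (cases "D 0 = 0")
    case False
    then have nz: "D (Suc i) \<noteq> 0" "\<tau> \<noteq> 0" using \<open>D 0 = \<tau> ^ Suc i * D (Suc i)\<close> subdegree_tau d by auto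
    have "subdegree (D 0) = Suc i * d + subdegree (D (Suc i))"
      using nz by (subst \<open>D 0 = \<tau> ^ Suc i * D (Suc i)\<close>) (simp add: subdegree_tau del: power_Suc mult_Suc)
    also have "\<dots> > i" using d by (metis Suc_le_eq le_add1 le_trans mult.right_neutral mult_le_mono2 One_nat_def)
    finally show ?thesis by (rule nth_less_subdegree_zero)
  qed simp
  then have "D 0 = 0" by (simp add: fps_eq_iff)
  then show ?thesis by (intro exI[of _ v]) (simp add: D_def G0)
qed

text \<open>The order of the j-th nonzero summand is congruent to j modulo d, so the orders are
  pairwise distinct and the term of lowest order cannot cancel.\<close>

lemma weierstrass_independent:
  assumes "(\<Sum>j<d. fps_X ^ j * (r j oo \<tau>)) = 0" "j < d"
  shows "r j = 0"
proof (rule ccontr)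
  assume rj: "r j \<noteq> 0"
  define J where "J = {j. j < d \<and> r j \<noteq> 0}"
  have "\<tau> \<noteq> 0" using subdegree_tau d by auto
  define s where "s j = j + subdegree (r j) * d" for j
  have s: "subdegree (fps_X ^ j * (r j oo \<tau>)) = s j" "fps_X ^ j * (r j oo \<tau>) \<noteq> 0" if "j \<in> J" for j
  proof -
    have "r j oo \<tau> \<noteq> 0" using that \<open>\<tau> \<noteq> 0\<close> by (simp add: J_def fps_compose_eq_0_iff tau_nth_0)
    then show "subdegree (fps_X ^ j * (r j oo \<tau>)) = s j" "fps_X ^ j * (r j oo \<tau>) \<noteq> 0"
      by (auto simp: s_def tau_nth_0 subdegree_tau)
  qed
  have "finite J" "J \<noteq> {}" using rj assms(2) by (auto simp: J_def)
  then obtain i where i: "i \<in> J" "\<And>j. j \<in> J \<Longrightarrow> s i \<le> s j"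
    by (metis arg_min_if_finite(1) arg_min_least)
  have smod: "s j mod d = j" if "j \<in> J" for j using that by (simp add: s_def J_def)
  have "(fps_X ^ j * (r j oo \<tau>)) $ s i = 0" if "j < d" "j \<noteq> i" for j
  proof (cases "j \<in> J")
    case True
    then have "s i < s j" using i smod that by (metis le_neq_implies_less)
    then show ?thesis using s(1)[OF True] by (metis nth_less_subdegree_zero)
  next
    case False
    then have "r j = 0" using that by (simp add: J_def)
    then show ?thesis by simp
  qed
  then have "(\<Sum>j\<in>{..<d} - {i}. (fps_X ^ j * (r j oo \<tau>)) $ s i) = 0" by (intro sum.neutral) auto
  moreover have "(\<Sum>j<d. (fps_X ^ j * (r j oo \<tau>)) $ s i) = 0"
    using assms(1) by (simp flip: fps_sum_nth)
  moreover have "i < d" using i by (simp add: J_def)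
  ultimately have "(fps_X ^ i * (r i oo \<tau>)) $ s i = 0" by (simp add: sum.remove[of _ i])
  then show False using s[OF i(1)] by (metis nth_subdegree_nonzero)
qed

end

text \<open>Writing \<open>y = 1 / x\<close> and \<open>\<tau> = a / f(x)\<close>, the l-th root of \<open>\<tau>\<close> is a power series in y;
  Weierstrass division turns it into a polynomial V in y over the power series in \<open>\<tau>\<close>, so that it
  can be evaluated at every root of \<open>f(X) = a / \<tau>\<close>.\<close>

lemma root_at_infinity_exists:
  fixes f :: "'k::field poly"
  assumes deg: "degree f > 0" and l: "of_nat l \<noteq> (0 :: 'k)" "l dvd degree f"
  shows "\<exists>V. \<forall>\<phi> :: 'k fps \<Rightarrow> 'm::field. \<forall>x. subring_hom UNIV \<phi> \<longrightarrow> (\<forall>u. \<phi> u = 0 \<longrightarrow> u = 0) \<longrightarrow> x \<noteq> 0 \<longrightarrow>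
     poly (map_poly (\<lambda>c. \<phi> (fps_const c)) f) x * \<phi> fps_X = \<phi> (fps_const (lead_coeff f)) \<longrightarrow>
     poly (map_poly \<phi> V) (inverse x) ^ l = \<phi> fps_X"
proof -
  define d where "d = degree f"
  define a where "a = lead_coeff f"
  have "a \<noteq> 0" using deg by (auto simp: a_def)
  \<comment> \<open>With y = 1 / x one has f(x) = a R(y) / y^d, where \<open>R\<close> has constant
    term 1. Hence y^d / R(y) is a / f(x).\<close>
  define R where "R = smult (inverse a) (reflect_poly f)"
  have "coeff R 0 = 1" using \<open>a \<noteq> 0\<close> by (simp add: R_def a_def)
  define F where "F = fps_of_poly R"
  have F0: "F $ 0 = 1" by (simp add: F_def \<open>coeff R 0 = 1\<close>)
  define \<tau> where "\<tau> = fps_X ^ d * inverse F"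
  have "F * inverse F = 1" using F0 by (simp add: inverse_mult_eq_1')
  then have \<tau>F: "\<tau> * F = fps_X ^ d" by (simp add: \<tau>_def mult_ac)
  have d: "d > 0" using deg by (simp add: d_def)
  have F0': "F $ 0 \<noteq> 0" using F0 by simp
  note \<tau>0 = tau_nth_0[OF d F0' \<tau>F]
  obtain \<kappa> where \<kappa>: "\<kappa> ^ l = inverse F" using fps_root_exists[of "inverse F" l] F0 l by auto
  obtain e where e: "d = l * e" using l d_def by (auto elim: dvdE)
  define v where "v = fps_X ^ e * \<kappa>"
  have vl: "v ^ l = \<tau>" by (simp add: v_def power_mult_distrib \<kappa> \<tau>_def e power_mult mult.commute flip: power_mult)
  obtain vs where vs: "v = (\<Sum>j<d. fps_X ^ j * (vs j oo \<tau>))"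
    using weierstrass_expansion[OF d F0' \<tau>F] by blast
  define V where "V = (\<Sum>j<d. monom (vs j) j)"
  \<comment> \<open>\<open>P\<close> is the equation of y over the power series in \<tau>. In
    \<open>P\<close> and \<open>V\<close> the series variable stands for \<tau> and the polynomial
    variable for y; \<open>E\<close> substitutes the actual \<tau> and y.\<close>
  define P where "P = monom 1 d - smult fps_X (map_poly fps_const R)"
  define E where "E p = poly (map_poly (\<lambda>u. u oo \<tau>) p) fps_X" for p :: "'k fps poly"
  have hom\<tau>: "subring_hom UNIV (\<lambda>u. u oo \<tau>)"
    by (rule subring_homI) (simp_all add: fps_compose_sub_distrib fps_compose_mult_distrib \<tau>0)
  have E: "E (p - q) = E p - E q" "E (p + q) = E p + E q" "E (p * q) = E p * E q" for p q
    by (simp_all add: E_def map_poly_hom[OF hom\<tau>])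
  have E1: "E 1 = 1" by (simp add: E_def)
  have Epow: "E (p ^ n) = E p ^ n" for p n by (induction n) (simp_all add: E E1)
  have EC: "E [:c:] = c oo \<tau>" for c by (simp add: E_def map_poly_pCons)
  have Esm: "E (smult c p) = (c oo \<tau>) * E p" for c p
    using E(3)[of "[:c:]" p] by (simp add: EC)
  have Emon: "E (monom c n) = (c oo \<tau>) * fps_X ^ n" for c n
    by (simp add: E_def map_poly_monom poly_monom)
  have E0: "E 0 = 0" by (simp add: E_def)
  have Esum: "E (sum g I) = (\<Sum>i\<in>I. E (g i))" for g :: "nat \<Rightarrow> 'k fps poly" and I
    by (induction I rule: infinite_finite_induct) (simp_all add: E E0)
  have EV: "E V = v" unfolding V_def Esum Emon vs by (simp add: mult.commute)
  have "E (map_poly fps_const R) = F"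
  proof -
    have "map_poly (\<lambda>u. u oo \<tau>) (map_poly fps_const R) = map_poly fps_const R"
      by (simp add: map_poly_map_poly o_def)
    moreover have "poly (map_poly fps_const R) fps_X = fps_of_poly R" for R :: "'k poly"
      by (induction R) (simp_all add: map_poly_pCons fps_of_poly_pCons mult.commute)
    ultimately show ?thesis by (simp add: E_def F_def)
  qed
  then have EP: "E P = 0" by (simp add: P_def E Emon Esm \<tau>0 \<tau>F)
  define W where "W = V ^ l - [:fps_X:]"
  have EW: "E W = 0" by (simp add: W_def E Epow EV EC vl \<tau>0)
  have "degree R \<le> d" unfolding R_def d_def using degree_reflect_poly_le[of f] by (metis degree_smult_le order_trans)
  have "degree P \<le> d" unfolding P_def
    using \<open>degree R \<le> d\<close> by (intro degree_le) (auto simp: coeff_map_poly coeff_eq_0)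
  have "coeff P d $ 0 = 1" by (simp add: P_def)
  then have "P \<noteq> 0" by auto
  \<comment> \<open>Both \<open>P\<close> and \<open>W\<close> vanish at y, and the remainder has
    degree below d, so independence of 1, ..., y^(d-1) makes it zero. The resulting identity c W = P
    Q is formal and may be evaluated at any root.\<close>
  obtain c Q where cQ: "c \<noteq> 0" "smult c W = P * Q + pseudo_mod W P"
    using pseudo_mod(1)[OF \<open>P \<noteq> 0\<close>] by blast
  define r where "r = pseudo_mod W P"
  have degr: "r = 0 \<or> degree r < d"
    using pseudo_mod(2)[OF \<open>P \<noteq> 0\<close>, of W] \<open>degree P \<le> d\<close> by (auto simp: r_def)
  have "E r = E (smult c W) - E (P * Q)" unfolding cQ(2) E by (simp add: r_def)
  then have Er: "E r = 0" by (simp add: E Esm EW EP)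
  have "r = (\<Sum>j<d. monom (coeff r j) j)"
  proof (rule poly_eqI)
    fix n
    have "coeff r n = 0" if "n \<ge> d" using degr that by (auto intro: coeff_eq_0)
    then show "coeff r n = coeff (\<Sum>j<d. monom (coeff r j) j) n"
      by (auto simp: coeff_sum if_distrib cong: if_cong)
  qed
  then have "E r = (\<Sum>j<d. fps_X ^ j * (coeff r j oo \<tau>))"
    by (metis (no_types, lifting) Emon Esum mult.commute sum.cong)
  then have "coeff r j = 0" if "j < d" for j
    using weierstrass_independent[OF d F0' \<tau>F _ that, of "coeff r"] Er by simp
  then have "r = 0" using \<open>r = (\<Sum>j<d. monom (coeff r j) j)\<close> by simp
  then have WPQ: "smult c W = P * Q" using cQ(2) by (simp add: r_def)
  show ?thesis
  proof (intro exI[of _ V] allI impI)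
    fix \<phi> :: "'k fps \<Rightarrow> 'm" and x
    assume \<phi>: "subring_hom UNIV \<phi>" and inj: "\<forall>u. \<phi> u = 0 \<longrightarrow> u = 0" and "x \<noteq> 0"
      and fx: "poly (map_poly (\<lambda>c. \<phi> (fps_const c)) f) x * \<phi> fps_X = \<phi> (fps_const (lead_coeff f))"
    define y where "y = inverse x"
    note hD = subring_homD[OF \<phi>] and h0 = subring_hom_0(2)[OF \<phi>]
    define N where "N p = poly (map_poly \<phi> p) y" for p
    have N: "N (p - q) = N p - N q" "N (p * q) = N p * N q" for p q
      by (simp_all add: N_def map_poly_hom[OF \<phi>])
    have "N 1 = 1" by (simp add: N_def hD(2))
    then have Npow: "N (p ^ n) = N p ^ n" for p n by (induction n) (simp_all add: N)
    have NC: "N [:c:] = \<phi> c" for c by (simp add: N_def map_poly_pCons h0)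
    have Nsm: "N (smult c p) = \<phi> c * N p" for c p using N(2)[of "[:c:]" p] by (simp add: NC)
    define \<psi> where "\<psi> c = \<phi> (fps_const c)" for c
    have \<psi>: "subring_hom UNIV \<psi>"
      by (rule subring_homI) (simp_all add: \<psi>_def hD flip: hD(5,6))
    have NR: "N (map_poly fps_const R) = poly (map_poly \<psi> R) y"
      by (simp add: N_def map_poly_map_poly o_def h0 \<psi>_def[abs_def])
    have "map_poly \<psi> (reflect_poly f) = reflect_poly (map_poly \<psi> f)"
    proof -
      have "degree (map_poly \<psi> f) = degree f"
        by (rule map_poly_degree_eq) (use deg inj in \<open>auto simp: \<psi>_def\<close>)
      then show ?thesis
        by (intro poly_eqI) (simp add: coeff_map_poly coeff_reflect_poly \<psi>_def h0)
    qed
    moreover have "degree (map_poly \<psi> f) = d"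
      unfolding d_def by (rule map_poly_degree_eq) (use deg inj in \<open>auto simp: \<psi>_def\<close>)
    ultimately have "poly (map_poly \<psi> (reflect_poly f)) y = y ^ d * poly (map_poly \<psi> f) x"
      using \<open>x \<noteq> 0\<close> by (simp add: poly_reflect_poly_nz y_def)
    moreover have "map_poly \<psi> (reflect_poly f) = smult (\<psi> a) (map_poly \<psi> R)"
    proof -
      have "reflect_poly f = smult a R" using \<open>a \<noteq> 0\<close> by (simp add: R_def)
      then show ?thesis using subring_homD(6)[OF \<psi>] subring_hom_0(2)[OF \<psi>] by (simp add: map_poly_smult)
    qed
    ultimately have "\<psi> a * poly (map_poly \<psi> R) y * \<phi> fps_X = y ^ d * (poly (map_poly \<psi> f) x * \<phi> fps_X)"
      by simp
    also have "\<dots> = y ^ d * \<psi> a" using fx by (simp add: \<psi>_def[abs_def] a_def)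
    finally have "poly (map_poly \<psi> R) y * \<phi> fps_X = y ^ d"
      using \<open>a \<noteq> 0\<close> inj by (auto simp: \<psi>_def mult_ac)
    moreover have "N (monom 1 d) = y ^ d" by (simp add: N_def map_poly_monom h0 hD(2) poly_monom)
    ultimately have "N P = 0" by (simp add: P_def N Nsm NR mult.commute)
    then have "\<phi> c * N W = 0" using WPQ by (metis N(2) Nsm mult_zero_left)
    then have "N W = 0" using cQ(1) inj by auto
    then show "poly (map_poly \<phi> V) (inverse x) ^ l = \<phi> fps_X"
      by (simp add: W_def N Npow NC) (simp add: N_def y_def)
  qed
qed

section \<open>Partial fractions\<close>

lemma poly_pderiv_prod_linear:
  fixes A :: "'l::field set"
  assumes "finite A" "r \<in> A"
  shows "poly (pderiv (smult c (\<Prod>s\<in>A. [:- s, 1:]))) r = c * (\<Prod>s\<in>A - {r}. r - s)"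
proof -
  have "(\<Prod>s\<in>A. [:- s, 1:]) = [:- r, 1:] * (\<Prod>s\<in>A - {r}. [:- s, 1:])"
    using assms by (rule prod.remove)
  then show ?thesis by (simp add: pderiv_smult pderiv_mult pderiv_pCons poly_prod del: mult_pCons_left)
qed

text \<open>This is Lagrange interpolation of the constant 1 at the nodes \<open>A\<close>: the
  interpolating polynomial has degree below \<open>card A\<close> and agrees with 1 on
  \<open>A\<close>.\<close>

lemma lagrange_sum_one:
  fixes A :: "'l::field set"
  assumes "finite A" "A \<noteq> {}"
  shows "(\<Sum>r\<in>A. (\<Prod>s\<in>A - {r}. z - s) / (\<Prod>s\<in>A - {r}. r - s)) = 1"
proof -
  define L where "L = (\<Sum>r\<in>A. smult (inverse (\<Prod>s\<in>A - {r}. r - s)) (\<Prod>s\<in>A - {r}. [:- s, 1:]))"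
  have card: "card A > 0" using assms by (simp add: card_gt_0_iff)
  have "degree L \<le> card A - 1"
    unfolding L_def
  proof (rule degree_sum_le)
    fix r assume "r \<in> A"
    have "degree (\<Prod>s\<in>A - {r}. [:- s, 1:]) \<le> (\<Sum>s\<in>A - {r}. degree [:- s, 1:])"
      using degree_prod_sum_le[of "A - {r}" "\<lambda>s. [:- s, 1:]"] assms by (simp add: o_def)
    also have "\<dots> = card A - 1" using assms \<open>r \<in> A\<close> by simp
    finally show "degree (smult (inverse (\<Prod>s\<in>A - {r}. r - s)) (\<Prod>s\<in>A - {r}. [:- s, 1:])) \<le> card A - 1"
      using degree_smult_le order_trans by blast
  qed (use assms in simp)
  then have "degree L < card A" using card by simp
  have "poly L x = 1" if x: "x \<in> A" for x
  proof -
    have "poly L x = (\<Sum>r\<in>A. if r = x then 1 else 0)"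
      unfolding L_def poly_sum
    proof (rule sum.cong)
      fix r assume r: "r \<in> A"
      show "poly (smult (inverse (\<Prod>s\<in>A - {r}. r - s)) (\<Prod>s\<in>A - {r}. [:- s, 1:])) x = (if r = x then 1 else 0)"
      proof (cases "r = x")
        case True
        then have "(\<Prod>s\<in>A - {x}. x - s) \<noteq> 0" using assms by auto
        then show ?thesis using True by (simp add: poly_prod)
      next
        case False
        then have "(\<Prod>s\<in>A - {r}. x - s) = 0" using assms x by (intro prod_zero) auto
        then show ?thesis using False by (simp add: poly_prod)
      qed
    qed simp
    then show ?thesis using assms x by simp
  qed
  then have "L = 1"
    by (intro poly_eqI_degree[of A]) (use \<open>degree L < card A\<close> card in auto)
  then have "poly L z = 1" by simp
  then show ?thesis by (simp add: L_def poly_sum poly_prod divide_inverse mult.commute)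
qed

lemma partial_fractions:
  fixes A :: "'l::field set"
  assumes A: "finite A" "A \<noteq> {}" and p: "p = smult c (\<Prod>s\<in>A. [:- s, 1:])" and z: "poly p z \<noteq> 0"
  shows "(\<Sum>r\<in>A. 1 / ((z - r) * poly (pderiv p) r)) = 1 / poly p z"
proof -
  have pz: "poly p z = c * (\<Prod>s\<in>A. z - s)" by (simp add: p poly_prod)
  have "1 / ((z - r) * poly (pderiv p) r)
      = (1 / poly p z) * ((\<Prod>s\<in>A - {r}. z - s) / (\<Prod>s\<in>A - {r}. r - s))" if "r \<in> A" for r
  proof -
    have "(\<Prod>s\<in>A. z - s) = (z - r) * (\<Prod>s\<in>A - {r}. z - s)" using A that by (simp add: prod.remove)
    moreover have "poly (pderiv p) r = c * (\<Prod>s\<in>A - {r}. r - s)"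
      unfolding p by (rule poly_pderiv_prod_linear) (use A that in auto)
    ultimately show ?thesis using z pz by auto
  qed
  then have "(\<Sum>r\<in>A. 1 / ((z - r) * poly (pderiv p) r))
      = (1 / poly p z) * (\<Sum>r\<in>A. (\<Prod>s\<in>A - {r}. z - s) / (\<Prod>s\<in>A - {r}. r - s))"
    by (simp add: sum_distrib_left)
  then show ?thesis using lagrange_sum_one[OF A] by simp
qed

text \<open>A linear factor occurring twice would make its root a common zero of \<open>p\<close>
  and its derivative, so the multiset of roots is a set.\<close>

lemma separable_splits:
  fixes p :: "'l::alg_closed_field poly"
  assumes sep: "\<And>x. poly p x = 0 \<Longrightarrow> poly (pderiv p) x \<noteq> 0" and p0: "p \<noteq> 0"
  shows "p = smult (lead_coeff p) (\<Prod>x\<in>{x. poly p x = 0}. [:- x, 1:])"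
    and "card {x. poly p x = 0} = degree p"
proof -
  define c where "c = lead_coeff p"
  have "c \<noteq> 0" using p0 by (simp add: c_def)
  obtain A where A: "size A = degree p" "p = smult c (\<Prod>x\<in>#A. [:- x, 1:])"
    using alg_closed_imp_factorization[OF p0] unfolding c_def by blast
  have "count A x = 1" if "x \<in># A" for x
  proof (rule ccontr)
    assume "count A x \<noteq> 1"
    define B where "B = A - {#x#}"
    have B: "A = add_mset x B" using that by (simp add: B_def)
    have "x \<in># B" using \<open>count A x \<noteq> 1\<close> unfolding B by (metis count_add_mset One_nat_def count_eq_zero_iff)
    then obtain C where C: "B = add_mset x C" by (metis mset_add)
    define D where "D = smult c (\<Prod>x\<in>#C. [:- x, 1:])"
    have "p = [:- x, 1:] * ([:- x, 1:] * D)"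
      unfolding A(2) by (simp add: D_def B C)
    then have "poly p x = 0 \<and> poly (pderiv p) x = 0"
      by (simp add: pderiv_mult del: mult_pCons_left)
    then show False using sep by blast
  qed
  then have A1: "A = mset_set (set_mset A)"
    by (intro multiset_eqI) (auto simp: count_mset_set' count_eq_zero_iff)
  have "{x. poly p x = 0} = set_mset A"
  proof -
    have "poly p x = c * (\<Prod>y\<in>#A. x - y)" for x
      unfolding A(2) by (simp add: poly_prod_mset)
    then show ?thesis using \<open>c \<noteq> 0\<close> by (auto simp: prod_mset_zero_iff)
  qed
  moreover have "(\<Prod>x\<in>#A. [:- x, 1:]) = (\<Prod>x\<in>set_mset A. [:- x, 1:])"
    by (subst A1) (simp add: prod_unfold_prod_mset)
  ultimately show "p = smult (lead_coeff p) (\<Prod>x\<in>{x. poly p x = 0}. [:- x, 1:])"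
    using A(2) unfolding c_def by metis
  have "size A = card (set_mset A)" by (subst A1) simp
  then show "card {x. poly p x = 0} = degree p" using A(1) \<open>{x. poly p x = 0} = set_mset A\<close> by simp
qed

section \<open>Finite fields inside the algebraic closure\<close>

lemma finite_field_power_card:
  fixes x :: "'a::{field,finite}"
  shows "x ^ card (UNIV :: 'a set) = x"
proof (cases "x = 0")
  case True
  then show ?thesis by (simp add: card_gt_0_iff)
next
  case False
  define U where "U = - {0 :: 'a}"
  have "(\<Prod>y\<in>U. y) = (\<Prod>y\<in>U. x * y)"
    by (rule prod.reindex_bij_witness[of _ "\<lambda>y. x * y" "\<lambda>y. y / x"]) (use False in \<open>auto simp: U_def\<close>)
  also have "\<dots> = x ^ card U * (\<Prod>y\<in>U. y)" by (simp add: prod.distrib)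
  finally have "x ^ card U = 1" by (simp add: U_def)
  moreover have "card (UNIV :: 'a set) = Suc (card U)"
    unfolding U_def by (metis Compl_eq_Diff_UNIV UNIV_I card.remove finite_code)
  ultimately show ?thesis by simp
qed

lemma prime_CHAR_finite: "prime CHAR('a::{field,finite})"
  using prime_CHAR_semidom[where ?'a = 'a] finite_imp_CHAR_pos[where ?'a = 'a] by simp

text \<open>Write the order as p^k m with m coprime to p. Since the p^k-th power map is an additive
  bijection and the q-th power map is the identity, the m-th power map is additive, which forces
  m = 1 by comparing derivatives.\<close>

lemma card_finite_field_prime_power:
  "\<exists>k. card (UNIV :: 'a::{field,finite} set) = CHAR('a) ^ k"
proof -
  define p where "p = CHAR('a)"
  define q where "q = card (UNIV :: 'a set)"
  have p: "prime p" unfolding p_def by (rule prime_CHAR_finite)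
  have q0: "q \<noteq> 0" by (simp add: q_def)
  obtain m where m: "q = p ^ multiplicity p q * m" "\<not> p dvd m"
    using multiplicity_decompose'[where x = q and p = p] q0 p not_prime_unit by blast
  define k where "k = multiplicity p q"
  have "m > 0" using m q0 by (metis gr0I mult_0_right)
  then have "m \<le> q" using m q0 by (intro dvd_imp_le) (auto intro: dvdI[of _ _ "p ^ multiplicity p q"] simp: mult.commute)
  have add: "(x + y) ^ (p ^ k) = x ^ (p ^ k) + y ^ (p ^ k)" for x y :: 'a
    by (rule freshmans_dream') (use p in \<open>simp_all add: p_def\<close>)
  have pow: "(x ^ (p ^ k)) ^ m = x" for x :: 'a
    using finite_field_power_card[of x] m(1) by (simp add: q_def k_def flip: power_mult)
  then have "inj (\<lambda>x :: 'a. x ^ (p ^ k))" by (metis injI)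
  then have surj: "surj (\<lambda>x :: 'a. x ^ (p ^ k))" by (simp add: finite_UNIV_inj_surj)
  have addm: "(u + 1) ^ m = u ^ m + 1" for u :: 'a
  proof -
    obtain x where x: "u = x ^ (p ^ k)" using surj by blast
    have "(u + 1) ^ m = ((x + 1) ^ (p ^ k)) ^ m" by (simp add: x add)
    also have "\<dots> = u ^ m + 1" by (simp only: pow x)
    finally show ?thesis .
  qed
  have "m = 1"
  proof (rule ccontr)
    assume "m \<noteq> 1"
    then have m2: "m \<ge> 2" using \<open>m > 0\<close> by simp
    have lin: "degree ([:1, 1:] ^ m :: 'a poly) = m" by (simp add: degree_power_eq)
    \<comment> \<open>Additivity gives agreement at all q points, and m is at most q. As the
      coefficients in degree m agree too, m points suffice.\<close>
    have "[:1, 1:] ^ m = (monom 1 m + 1 :: 'a poly)"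
    proof (rule poly_eqI_degree_lead_coeff[where A = UNIV and n = m])
      have "coeff ([:1, 1:] ^ m) m = lead_coeff ([:1, 1:] ^ m :: 'a poly)" by (simp add: lin)
      then show "coeff ([:1, 1:] ^ m) m = coeff (monom 1 m + 1 :: 'a poly) m"
        using \<open>m > 0\<close> by (simp add: lead_coeff_power)
      show "m \<le> card (UNIV :: 'a set)" using \<open>m \<le> q\<close> by (simp add: q_def)
      show "degree ([:1, 1:] ^ m :: 'a poly) \<le> m" using lin by simp
      show "degree (monom 1 m + 1 :: 'a poly) \<le> m" by (intro degree_add_le) (auto simp: degree_monom_le)
      show "poly ([:1, 1:] ^ m) z = poly (monom 1 m + 1) z" for z :: 'a
        using addm[of z] by (simp add: poly_monom add.commute)
    qed
    then have "poly (pderiv ([:1, 1:] ^ m)) 0 = poly (pderiv (monom 1 m + 1 :: 'a poly)) 0" by simp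
    then have "of_nat m = (0 :: 'a)"
      using m2 by (simp add: pderiv_power pderiv_pCons pderiv_add pderiv_monom poly_monom power_0_left)
    then show False using m(2) by (simp add: of_nat_eq_0_iff_char_dvd p_def)
  qed
  then have "q = p ^ k" using m(1) by (simp add: k_def)
  then show ?thesis by (auto simp: p_def q_def)
qed

lemma finite_field_card_gt_1: "card (UNIV :: 'a::{field,finite} set) > 1"
proof -
  have "card {0, 1 :: 'a} \<le> card (UNIV :: 'a set)" by (rule card_mono) auto
  then show ?thesis by simp
qed

lemma card_power_CHAR_power: "\<exists>k. card (UNIV :: 'a::{field,finite} set) ^ n = CHAR('a) ^ k"
  using card_finite_field_prime_power[where 'a = 'a] by (metis power_mult)

lemma of_nat_card_finite_field:
  assumes "CHAR('l::comm_semiring_1) = CHAR('a::{field,finite})" "n > 0"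
  shows "of_nat (card (UNIV :: 'a set) ^ n) = (0 :: 'l)"
proof -
  obtain k where k: "card (UNIV :: 'a set) ^ n = CHAR('a) ^ k" using card_power_CHAR_power by blast
  have "card (UNIV :: 'a set) ^ n > 1" by (rule one_less_power[OF finite_field_card_gt_1 assms(2)])
  then have "k \<noteq> 0" using k by (intro notI) simp
  then have "CHAR('l) dvd card (UNIV :: 'a set) ^ n" unfolding k assms(1) by simp
  then show ?thesis by (simp only: of_nat_eq_0_iff_char_dvd)
qed

lemma power_card_add:
  fixes x y :: "'l::comm_ring_1"
  assumes "CHAR('l) = CHAR('a::{field,finite})"
  shows "(x + y) ^ (card (UNIV :: 'a set) ^ n) = x ^ (card (UNIV :: 'a set) ^ n) + y ^ (card (UNIV :: 'a set) ^ n)"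
proof -
  obtain k where "card (UNIV :: 'a set) ^ n = CHAR('a) ^ k" using card_power_CHAR_power by blast
  then show ?thesis
    using freshmans_dream'[where ?'a = 'l] prime_CHAR_finite[where 'a = 'a] assms by simp
qed

lemma subring_hom_power_card:
  assumes "CHAR('l::comm_ring_1) = CHAR('a::{field,finite})"
  shows "subring_hom UNIV (\<lambda>x :: 'l. x ^ (card (UNIV :: 'a set) ^ n))"
proof (rule subring_homI)
  fix x y :: 'l
  show "(x - y) ^ (card (UNIV :: 'a set) ^ n) = x ^ (card (UNIV :: 'a set) ^ n) - y ^ (card (UNIV :: 'a set) ^ n)"
    using power_card_add[OF assms, of "x - y" y n] by (simp add: algebra_simps)
qed (simp_all add: power_mult_distrib)

lemma to_ac_power_card:
  "to_ac (x :: 'a::{field,finite}) ^ (card (UNIV :: 'a set) ^ n) = to_ac x"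
proof -
  have "x ^ (card (UNIV :: 'a set) ^ n) = x"
    by (induction n) (simp_all add: power_mult finite_field_power_card)
  then show ?thesis by (metis to_ac_power)
qed

text \<open>The coefficients come from the field of order q and are fixed by the q-th power map,
  which is a ring homomorphism.\<close>

lemma poly_frobenius:
  fixes f :: "'a::{field,finite} poly" and \<phi> :: "'a \<Rightarrow> 'l::comm_ring_1"
  assumes \<phi>: "subring_hom UNIV \<phi>" and CHAR: "CHAR('l) = CHAR('a)"
  shows "poly (map_poly \<phi> f) (z ^ (card (UNIV :: 'a set) ^ n)) = poly (map_poly \<phi> f) z ^ (card (UNIV :: 'a set) ^ n)"
proof -
  define Q where "Q = card (UNIV :: 'a set) ^ n"
  have "c ^ Q = c" for c :: 'a
    unfolding Q_def by (induction n) (simp_all add: power_mult finite_field_power_card)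
  then have "\<phi> c ^ Q = \<phi> c" for c using subring_hom_power(2)[OF \<phi> UNIV_I, of c Q] by simp
  moreover have "(0 :: 'l) ^ Q = 0"
    using subring_hom_0(2)[OF subring_hom_power_card[OF CHAR, of n]] by (simp add: Q_def)
  ultimately have "map_poly (\<lambda>x. x ^ Q) (map_poly \<phi> f) = map_poly \<phi> f"
    by (simp add: map_poly_map_poly o_def subring_hom_0[OF \<phi>])
  then show ?thesis
    using subring_hom_poly(2)[OF subring_hom_power_card[OF CHAR, of n] polys_over_UNIV UNIV_I, of "map_poly \<phi> f" z]
    by (simp add: Q_def)
qed

text \<open>The derivative of X^Q - X is -1 because Q vanishes in the field, so there are no
  repeated roots.\<close>

lemma ff_ext_splits:
  fixes n :: nat
  assumes "n \<ge> 1"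
  defines "P \<equiv> monom 1 (card (UNIV :: 'a::{field,finite} set) ^ n) - monom 1 1 :: 'a alg_closure poly"
  shows "P = (\<Prod>c\<in>ff_ext n. [:- c, 1:])" and "finite (ff_ext n :: 'a alg_closure set)"
    and "ff_ext n \<noteq> ({} :: 'a alg_closure set)"
proof -
  define Q where "Q = card (UNIV :: 'a set) ^ n"
  have Q: "Q > 1" unfolding Q_def
    by (intro one_less_power finite_field_card_gt_1) (use assms(1) in simp)
  have "of_nat Q = (0 :: 'a alg_closure)" unfolding Q_def
    by (rule of_nat_card_finite_field) (use assms(1) in simp_all)
  then have dP: "pderiv P = - 1"
    by (simp add: P_def pderiv_diff pderiv_monom flip: Q_def)
  have c1: "coeff P Q = 1" using Q by (simp add: P_def Q_def)
  have "degree P \<le> Q" using Q unfolding P_def Q_def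
    by (intro degree_diff_le) (auto simp: degree_monom_eq)
  then have "lead_coeff P = 1" using c1 by (metis le_degree le_antisym zero_neq_one)
  then have "P \<noteq> 0" by auto
  have roots: "{x. poly P x = 0} = ff_ext n"
    by (auto simp: P_def poly_monom ff_ext_def)
  have "P = smult (lead_coeff P) (\<Prod>x\<in>{x. poly P x = 0}. [:- x, 1:])"
    by (rule separable_splits(1)) (use dP \<open>P \<noteq> 0\<close> in auto)
  then show "P = (\<Prod>c\<in>ff_ext n. [:- c, 1:])" using \<open>lead_coeff P = 1\<close> roots by simp
  show "finite (ff_ext n :: 'a alg_closure set)" using poly_roots_finite[OF \<open>P \<noteq> 0\<close>] roots by simp
  have "0 \<in> (ff_ext n :: 'a alg_closure set)" using Q by (simp add: ff_ext_def Q_def card_gt_0_iff)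
  then show "ff_ext n \<noteq> ({} :: 'a alg_closure set)" by blast
qed

lemma ff_ext_product:
  fixes \<kappa> :: "'a::{field,finite} alg_closure \<Rightarrow> 'l::field"
  assumes "n \<ge> 1" and \<kappa>: "subring_hom UNIV \<kappa>"
  shows "monom 1 (card (UNIV :: 'a set) ^ n) - monom 1 1 = (\<Prod>c\<in>\<kappa> ` ff_ext n. [:- c, 1:])"
proof -
  note h0 = subring_hom_0(2)[OF \<kappa>] and h1 = subring_homD(2)[OF \<kappa>]
  have prod: "map_poly \<kappa> (\<Prod>c\<in>A. [:- c, 1:]) = (\<Prod>c\<in>A. [:- \<kappa> c, 1:])" for A
    by (induction A rule: infinite_finite_induct)
      (simp_all add: map_poly_hom[OF \<kappa>] map_poly_pCons h0 h1 subring_hom_uminus[OF \<kappa>] del: mult_pCons_left)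
  have inj: "inj \<kappa>" by (rule subring_hom_inj[OF \<kappa>])
  have "monom 1 (card (UNIV :: 'a set) ^ n) - monom 1 1 = map_poly \<kappa> (monom 1 (card (UNIV :: 'a set) ^ n) - monom 1 1)"
    by (simp add: map_poly_hom[OF \<kappa>] map_poly_monom h0 h1)
  also have "\<dots> = (\<Prod>c\<in>ff_ext n. [:- \<kappa> c, 1:])"
    by (simp only: ff_ext_splits(1)[OF assms(1)] prod)
  also have "\<dots> = (\<Prod>c\<in>\<kappa> ` ff_ext n. [:- c, 1:])"
    using inj by (subst prod.reindex) (auto intro: inj_on_subset)
  finally show ?thesis .
qed

text \<open>Pushing the differential \<open>dx / (x^Q - x)\<close> forward along \<open>t = f(x)\<close> gives \<open>dt / (t^Q - t)\<close>
  when f permutes the field of order Q: compare residues at its elements.\<close>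

lemma trace_identity:
  fixes f :: "'a::{field,finite} poly" and \<kappa> :: "'a alg_closure \<Rightarrow> 'l::field" and R :: "'l set"
  defines "F \<equiv> map_poly (\<lambda>c. \<kappa> (to_ac c)) f"
  assumes CHAR: "CHAR('l) = CHAR('a)" and n: "n \<ge> 1" and \<kappa>: "subring_hom UNIV \<kappa>"
    and bij: "bij_betw (\<lambda>c. poly (map_poly to_ac f) c) (ff_ext n :: 'a alg_closure set) (ff_ext n)"
    and R: "finite R" "R \<noteq> {}" "F - [:t:] = smult a (\<Prod>r\<in>R. [:- r, 1:])" "a \<noteq> 0"
    and t: "t ^ (card (UNIV :: 'a set) ^ n) \<noteq> t"
  defines "Q \<equiv> card (UNIV :: 'a set) ^ n"
  shows "(\<Sum>r\<in>R. (poly F (r ^ Q) - poly F r) / ((r ^ Q - r) * poly (pderiv F) r)) = 1"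
proof -
  define S where "S = \<kappa> ` (ff_ext n :: 'a alg_closure set)"
  have S: "finite S" "S \<noteq> {}" using ff_ext_splits(2,3)[OF n, where 'a = 'a] by (auto simp: S_def)
  define P where "P = (monom 1 Q - monom 1 1 :: 'l poly)"
  have PS: "P = smult 1 (\<Prod>c\<in>S. [:- c, 1:])"
    unfolding P_def Q_def S_def using ff_ext_product[OF n \<kappa>] by simp
  have "of_nat Q = (0 :: 'l)" unfolding Q_def by (rule of_nat_card_finite_field[OF CHAR]) (use n in simp)
  then have dP: "pderiv P = - 1"
    by (simp add: P_def pderiv_diff pderiv_monom)
  have pP: "poly P z = z ^ Q - z" for z by (simp add: P_def poly_monom)
  \<comment> \<open>All residues of 1 / (z^Q - z) are -1, since the derivative of z^Q - z is
    -1.\<close>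
  have invP: "1 / (z ^ Q - z) = - (\<Sum>c\<in>S. 1 / (z - c))" if "z ^ Q \<noteq> z" for z
  proof -
    have "- (\<Sum>c\<in>S. 1 / (z - c)) = (\<Sum>c\<in>S. 1 / ((z - c) * poly (pderiv P) c))"
      by (simp add: dP minus_divide_right flip: sum_negf)
    also have "\<dots> = 1 / (z ^ Q - z)"
      using partial_fractions[OF S PS, of z] that by (simp add: pP)
    finally show ?thesis by simp
  qed
  have rt: "poly F r = t" if "r \<in> R" for r
  proof -
    have "poly (F - [:t:]) r = 0" unfolding R(3) using that R(1) by (auto simp: poly_prod)
    then show ?thesis by simp
  qed
  have \<kappa>0: "subring_hom UNIV (\<lambda>c. \<kappa> (to_ac (c :: 'a)))"
    using subring_homD[OF \<kappa>] by (intro subring_homI) simp_all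
  have frob: "poly F (z ^ Q) = poly F z ^ Q" for z
    unfolding F_def Q_def by (rule poly_frobenius[OF \<kappa>0 CHAR])
  have evF: "poly F (\<kappa> c) = \<kappa> (poly (map_poly to_ac f) c)" for c
    using subring_hom_poly(2)[OF \<kappa> polys_over_UNIV UNIV_I, of "map_poly to_ac f" c]
    by (simp add: F_def map_poly_map_poly o_def subring_hom_0[OF \<kappa>])
  have SQ: "c ^ Q = c" if cS: "c \<in> S" for c
  proof -
    obtain x where x: "c = \<kappa> x" "x ^ Q = x" using cS by (auto simp: S_def ff_ext_def Q_def)
    then show ?thesis using subring_hom_power(2)[OF \<kappa> UNIV_I, of x Q] by simp
  qed
  have bijS: "bij_betw (poly F) S S"
  proof -
    have inj: "inj \<kappa>" by (rule subring_hom_inj[OF \<kappa>])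
    have "poly F ` S = \<kappa> ` ((\<lambda>c. poly (map_poly to_ac f) c) ` ff_ext n)"
      unfolding S_def image_image evF ..
    then have "poly F ` S = S" using bij_betw_imp_surj_on[OF bij] by (simp add: S_def)
    moreover have "inj_on (poly F) S"
      unfolding S_def
    proof (rule inj_onI)
      fix x y assume "x \<in> \<kappa> ` ff_ext n" "y \<in> \<kappa> ` ff_ext n" and eq: "poly F x = poly F y"
      then obtain u v where uv: "x = \<kappa> u" "y = \<kappa> v" "u \<in> ff_ext n" "v \<in> ff_ext n" by blast
      then have "poly (map_poly to_ac f) u = poly (map_poly to_ac f) v"
        using eq inj by (simp add: evF inj_eq)
      then show "x = y" using uv bij_betw_imp_inj_on[OF bij] by (auto dest: inj_onD)
    qed
    ultimately show ?thesis by (simp add: bij_betw_def)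
  qed
  have tS: "t \<notin> S" using SQ t by (auto simp: Q_def)
  have FcS: "poly F c \<in> S" if "c \<in> S" for c using bijS that by (auto simp: bij_betw_def)
  have rQ: "r ^ Q \<noteq> r" if "r \<in> R" for r
    using frob[of r] rt[OF that] t by (auto simp: Q_def)
  have pd: "pderiv (F - [:t:]) = pderiv F" by (simp add: pderiv_diff pderiv_pCons)
  have "(\<Sum>r\<in>R. 1 / ((r ^ Q - r) * poly (pderiv F) r))
      = (\<Sum>r\<in>R. \<Sum>c\<in>S. 1 / ((c - r) * poly (pderiv F) r))"
  proof (rule sum.cong)
    fix r assume r: "r \<in> R"
    have "1 / ((r ^ Q - r) * poly (pderiv F) r) = (1 / (r ^ Q - r)) * (1 / poly (pderiv F) r)" by simp
    also have "\<dots> = (\<Sum>c\<in>S. - (1 / (r - c)) * (1 / poly (pderiv F) r))"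
      by (simp only: invP[OF rQ[OF r]] sum_negf[symmetric] sum_distrib_right)
    also have "\<dots> = (\<Sum>c\<in>S. 1 / ((c - r) * poly (pderiv F) r))"
      by (rule sum.cong) (simp_all add: minus_divide_right)
    finally show "1 / ((r ^ Q - r) * poly (pderiv F) r) = (\<Sum>c\<in>S. 1 / ((c - r) * poly (pderiv F) r))" .
  qed simp
  also have "\<dots> = (\<Sum>c\<in>S. \<Sum>r\<in>R. 1 / ((c - r) * poly (pderiv F) r))" by (rule sum.swap)
  \<comment> \<open>The inner sum is the partial fraction expansion of 1 / (F - t) over the roots
    \<open>R\<close>, taken at c.\<close>
  also have "\<dots> = (\<Sum>c\<in>S. 1 / (poly F c - t))"
  proof (rule sum.cong)
    fix c assume "c \<in> S"
    then have "poly (F - [:t:]) c \<noteq> 0" using FcS tS by auto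
    from partial_fractions[OF R(1-3) this] show "(\<Sum>r\<in>R. 1 / ((c - r) * poly (pderiv F) r)) = 1 / (poly F c - t)"
      by (simp add: pd)
  qed simp
  \<comment> \<open>The values of \<open>F\<close> on \<open>S\<close> run through \<open>S\<close>
    exactly once.\<close>
  also have "\<dots> = (\<Sum>c\<in>S. 1 / (c - t))"
    by (rule sum.reindex_bij_betw[OF bijS])
  also have "\<dots> = - (\<Sum>c\<in>S. 1 / (t - c))"
    by (simp add: sum_negf[symmetric] minus_divide_right)
  also have "\<dots> = 1 / (t ^ Q - t)" using invP[of t] t by (simp add: Q_def)
  finally have "(t ^ Q - t) * (\<Sum>r\<in>R. 1 / ((r ^ Q - r) * poly (pderiv F) r)) = 1"
    using t by (simp add: Q_def)
  \<comment> \<open>\<open>F\<close> commutes with the Q-th power, so all numerators are equal to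
    t^Q - t.\<close>
  moreover have "(\<Sum>r\<in>R. (poly F (r ^ Q) - poly F r) / ((r ^ Q - r) * poly (pderiv F) r))
      = (t ^ Q - t) * (\<Sum>r\<in>R. 1 / ((r ^ Q - r) * poly (pderiv F) r))"
    unfolding sum_distrib_left by (rule sum.cong) (simp_all add: frob rt)
  ultimately show ?thesis by simp
qed

section \<open>The roots of \<open>f(X) = t\<close> over an unramified point\<close>

text \<open>For y = x^Q the quotient becomes a combination of powers of x^Q whose coefficients do
  not involve Q. In a field, the same identity makes the double sum vanish at two distinct points
  where \<open>F\<close> takes equal values. Both readings are used.\<close>

lemma poly_difference_quotient:
  fixes F :: "'l::comm_ring_1 poly"
  assumes "degree F \<le> d"
  shows "poly F y - poly F x = (y - x) * (\<Sum>k\<le>d. \<Sum>i<k. coeff F k * x ^ (k - Suc i) * y ^ i)"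
proof -
  have "poly F z = (\<Sum>k\<le>d. coeff F k * z ^ k)" for z
    unfolding poly_altdef by (rule sum.mono_neutral_left) (use assms in \<open>auto simp: coeff_eq_0\<close>)
  then have "poly F y - poly F x = (\<Sum>k\<le>d. coeff F k * (y ^ k - x ^ k))"
    by (simp add: sum_subtractf algebra_simps)
  also have "\<dots> = (\<Sum>k\<le>d. (y - x) * (\<Sum>i<k. coeff F k * x ^ (k - Suc i) * y ^ i))"
  proof (rule sum.cong)
    fix k
    have "y ^ k - x ^ k = (y - x) * (\<Sum>i<k. x ^ (k - Suc i) * y ^ i)" 
      by (cases k) (simp_all add: diff_power_eq_sum mult.commute del: power_Suc)
    then show "coeff F k * (y ^ k - x ^ k) = (y - x) * (\<Sum>i<k. coeff F k * x ^ (k - Suc i) * y ^ i)"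
      by (simp add: sum_distrib_left mult_ac)
  qed simp
  finally show ?thesis by (simp add: sum_distrib_left)
qed

lemma poly_splits_if_card_roots:
  fixes p :: "'l::field poly"
  assumes "finite S" "card S = degree p" "\<And>x. x \<in> S \<Longrightarrow> poly p x = 0"
  shows "p = smult (lead_coeff p) (\<Prod>x\<in>S. [:- x, 1:])"
proof (rule poly_eqI_degree_lead_coeff[where A = S and n = "degree p"])
  define q where "q = (\<Prod>x\<in>S. [:- x, 1:])"
  have "degree q = degree p"
    using assms(2) unfolding q_def by (simp add: degree_prod_sum_eq)
  moreover have "lead_coeff q = (\<Prod>x\<in>S. lead_coeff [:- x, 1:])"
    unfolding q_def by (rule lead_coeff_prod)
  ultimately have q: "degree q = degree p" "coeff q (degree p) = 1" by simp_all
  then show "coeff p (degree p) = coeff (smult (lead_coeff p) (\<Prod>x\<in>S. [:- x, 1:])) (degree p)"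
    by (simp flip: q_def)
  show "degree (smult (lead_coeff p) (\<Prod>x\<in>S. [:- x, 1:])) \<le> degree p"
    using q degree_smult_le[of "lead_coeff p" q] by (simp add: q_def)
  show "poly p z = poly (smult (lead_coeff p) (\<Prod>x\<in>S. [:- x, 1:])) z" if "z \<in> S" for z
    using that assms by (auto simp: poly_prod)
qed (use assms in auto)

lemma infinite_alg_closed: "infinite (UNIV :: 'k::alg_closed_field set)"
proof
  assume fin: "finite (UNIV :: 'k set)"
  define p where "p = (\<Prod>x\<in>UNIV. [:- x, 1:]) + (1 :: 'k poly)"
  have d: "degree (\<Prod>x\<in>(UNIV :: 'k set). [:- x, 1:]) = card (UNIV :: 'k set)"
    by (simp add: degree_prod_sum_eq)
  have "card (UNIV :: 'k set) > 0" using fin by (simp add: card_gt_0_iff)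
  then have "degree p > 0" unfolding p_def using d by (subst degree_add_eq_left) auto
  then obtain x where "poly p x = 0" using alg_closed_imp_poly_has_root by blast
  moreover have "(\<Prod>y\<in>UNIV. x - y) = 0" using fin by (intro prod_zero) auto
  ultimately show False by (simp add: p_def poly_prod)
qed

lemma fps_compose_of_poly_shifted:
  fixes B :: "'k::field fps"
  assumes "B $ 0 = 0"
  shows "fps_of_poly (pcompose p [:c, 1:]) oo B = poly (map_poly fps_const p) (fps_const c + B)"
proof (induction p)
  case 0 then show ?case by simp
next
  case (pCons a p)
  have "fps_of_poly (pcompose (pCons a p) [:c, 1:]) oo B
      = (fps_const a + (fps_const c + fps_X) * fps_of_poly (pcompose p [:c, 1:])) oo B"
    by (simp only: pcompose_pCons fps_of_poly_add fps_of_poly_mult fps_of_poly_const fps_of_poly_pCons)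
      (simp add: algebra_simps)
  also have "\<dots> = fps_const a + (fps_const c + B) * (fps_of_poly (pcompose p [:c, 1:]) oo B)"
    by (simp only: fps_compose_add_distrib fps_compose_mult_distrib[OF assms] fps_const_compose
        fps_X_fps_compose_startby0[OF assms])
  finally show ?case by (simp add: pCons.IH map_poly_pCons)
qed

text \<open>Hensel's lemma by reversion of series: g(c + X) - g(c) has no constant term and a
  nonzero linear coefficient, and c plus its compositional inverse is the root.\<close>

lemma fps_simple_root_exists:
  fixes g :: "'k::field poly"
  assumes "poly (pderiv g) c \<noteq> 0"
  shows "\<exists>r. r $ 0 = c \<and> poly (map_poly fps_const g) r = fps_const (poly g c) + fps_X"
proof -
  define h where "h = pcompose g [:c, 1:] - [:poly g c:]"
  define H where "H = fps_of_poly h"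
  have "coeff h 0 = poly h 0" by (simp add: poly_0_coeff_0)
  then have H0: "H $ 0 = 0" by (simp add: H_def h_def poly_pcompose)
  have "coeff h 1 = coeff (pderiv h) 0" by (simp add: coeff_pderiv)
  also have "\<dots> = poly (pderiv h) 0" by (simp add: poly_0_coeff_0)
  also have "\<dots> = poly (pderiv g) c"
    by (simp add: h_def pderiv_diff pderiv_pcompose pderiv_pCons poly_pcompose)
  finally have H1: "H $ 1 \<noteq> 0" using assms by (simp add: H_def)
  define B where "B = fps_inv H"
  have B0: "B $ 0 = 0" by (simp add: B_def fps_inv_def)
  have "H oo B = fps_X" unfolding B_def by (rule fps_inv_right[OF H0 H1])
  moreover have "H oo B = poly (map_poly fps_const g) (fps_const c + B) - fps_const (poly g c)"
    by (simp add: H_def h_def fps_of_poly_simps fps_compose_sub_distrib fps_compose_of_poly_shifted[OF B0])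
  ultimately show ?thesis using B0
    by (intro exI[of _ "fps_const c + B"]) (simp add: algebra_simps)
qed

text \<open>There are finitely many critical values, and an algebraically closed field is infinite.
  Subtracting a noncritical value leaves a separable polynomial.\<close>

lemma unramified_value_exists:
  fixes g :: "'k::alg_closed_field poly"
  assumes "pderiv g \<noteq> 0"
  shows "\<exists>t0. (\<forall>c. poly g c = t0 \<longrightarrow> poly (pderiv g) c \<noteq> 0) \<and> card {c. poly g c = t0} = degree g"
proof -
  have "finite (poly g ` {c. poly (pderiv g) c = 0})" using poly_roots_finite[OF assms] by blast
  then obtain t0 where t0: "t0 \<notin> poly g ` {c. poly (pderiv g) c = 0}"
    using infinite_alg_closed ex_new_if_finite by blast
  have deg: "degree g > 0" using assms 
    by (metis degree_eq_zeroE gr0I pCons_0_0 pderiv_0 pderiv_pCons add.right_neutral)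
  have d: "degree (g - [:t0:]) = degree g"
    unfolding diff_conv_add_uminus by (rule degree_add_eq_left) (use deg in simp)
  have "card {x. poly (g - [:t0:]) x = 0} = degree (g - [:t0:])"
  proof (rule separable_splits(2))
    show "poly (pderiv (g - [:t0:])) x \<noteq> 0" if "poly (g - [:t0:]) x = 0" for x
      using that t0 by (auto simp: pderiv_diff pderiv_pCons)
    show "g - [:t0:] \<noteq> 0" using d deg by auto
  qed
  then show ?thesis using t0 d by (intro exI[of _ t0]) auto
qed

section \<open>Frobenius orbits of algebraic elements\<close>

text \<open>All iterates x^(q^i) are roots of one nonzero polynomial over the base field, so two of
  them coincide; injectivity of Frobenius cancels the smaller exponent.\<close>

lemma in_some_ff_ext:
  fixes x :: "'a::{field,finite} alg_closure"
  shows "\<exists>c>0. x ^ (card (UNIV :: 'a set) ^ c) = x"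
proof -
  define q where "q = card (UNIV :: 'a set)"
  obtain p :: "'a poly" where p: "p \<noteq> 0" "poly (map_poly to_ac p) x = 0"
    using alg_closure_algebraic by blast
  have C: "CHAR('a alg_closure) = CHAR('a)" by simp
  note hom = subring_hom_power_card[OF C]
  have root: "poly (map_poly to_ac p) (x ^ q ^ i) = 0" for i
  proof -
    have "map_poly (\<lambda>y. y ^ q ^ i) (map_poly to_ac p) = map_poly to_ac p"
      using subring_hom_0(2)[OF hom[of i]] to_ac_power_card[of _ i, where 'a = 'a]
      by (simp add: map_poly_map_poly o_def q_def)
    then have "poly (map_poly to_ac p) (x ^ q ^ i) = (poly (map_poly to_ac p) x) ^ q ^ i"
      using subring_hom_poly(2)[OF hom[of i] polys_over_UNIV UNIV_I, of "map_poly to_ac p" x] by (simp add: q_def)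
    also have "\<dots> = 0" using p subring_hom_0(2)[OF hom[of i]] by (simp add: q_def)
    finally show ?thesis .
  qed
  have "map_poly to_ac p \<noteq> 0"
    using p subring_hom_0 by (subst map_poly_eq_0_iff) auto
  then have "finite {y. poly (map_poly to_ac p) y = 0}" by (rule poly_roots_finite)
  then have "finite ((\<lambda>i. x ^ q ^ i) ` UNIV)" by (rule finite_subset[rotated]) (use root in auto)
  then have "\<not> inj (\<lambda>i. x ^ q ^ i)" using finite_imageD infinite_UNIV_nat by blast
  then obtain i j where ij: "x ^ q ^ i = x ^ q ^ j" "i < j"
    unfolding inj_def by (metis linorder_neqE_nat)
  have "x ^ q ^ j = (x ^ q ^ (j - i)) ^ q ^ i"
  proof -
    have "j = (j - i) + i" using ij(2) by simp
    then have "x ^ q ^ j = x ^ q ^ ((j - i) + i)" by (rule arg_cong)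
    then show ?thesis by (simp only: power_add power_mult)
  qed
  then have "(x ^ q ^ (j - i) - x) ^ q ^ i = 0"
    using ij(1) subring_homD(5)[OF hom[of i] UNIV_I UNIV_I, of "x ^ q ^ (j - i)" x]
    unfolding q_def by (metis eq_iff_diff_eq_0)
  then have "x ^ q ^ (j - i) = x" by (metis eq_iff_diff_eq_0 power_not_zero)
  then show ?thesis using ij(2) by (intro exI[of _ "j - i"]) (simp add: q_def)
qed

text \<open>The finite set \<open>Z\<close> lies in one finite field, on which z^(q^n) depends only
  on n modulo \<open>C\<close>. By pigeonhole some residue class meets \<open>S\<close> infinitely
  often, and a member of it serves as \<rho>.\<close>

lemma frobenius_class_infinite:
  fixes Z :: "'a::{field,finite} alg_closure set"
  assumes "finite Z" "infinite S"
  shows "\<exists>\<rho> N. N \<subseteq> S \<and> infinite N \<and> (\<forall>z\<in>Z. \<forall>n\<in>N. z ^ (card (UNIV :: 'a set) ^ n) = z ^ (card (UNIV :: 'a set) ^ \<rho>))"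
proof -
  define q where "q = card (UNIV :: 'a set)"
  obtain c where c: "\<And>z. c z > 0" "\<And>z :: 'a alg_closure. z ^ q ^ c z = z"
    using in_some_ff_ext unfolding q_def by metis
  define C where "C = (\<Prod>z\<in>Z. c z)"
  have "C > 0" using c(1) by (simp add: C_def prod_pos)
  have iter: "z ^ q ^ (c z * m) = z" for z m
  proof (induction m)
    case (Suc m)
    have "z ^ q ^ (c z * Suc m) = (z ^ q ^ c z) ^ q ^ (c z * m)"
      by (simp only: mult_Suc_right power_add power_mult)
    then show ?case using Suc by (simp only: c(2))
  qed simp
  have red: "z ^ q ^ n = z ^ q ^ (n mod C)" if "z \<in> Z" for z n
  proof -
    have "c z dvd C" unfolding C_def by (rule dvd_prodI) (use assms(1) that in auto)
    then obtain m where m: "C = c z * m" by (rule dvdE)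
    have "n = c z * (m * (n div C)) + n mod C"
      using div_mult_mod_eq[of n C] m by (simp add: mult_ac)
    then have "z ^ q ^ n = z ^ q ^ (c z * (m * (n div C)) + n mod C)" by (rule arg_cong)
    also have "\<dots> = (z ^ q ^ (c z * (m * (n div C)))) ^ q ^ (n mod C)"
      by (simp only: power_add power_mult)
    finally show ?thesis by (simp only: iter)
  qed
  have "finite ((\<lambda>n. n mod C) ` S)"
    by (rule finite_subset[of _ "{..<C}"]) (use \<open>C > 0\<close> in auto)
  from pigeonhole_infinite[OF assms(2) this] obtain n0 where n0: "infinite {n \<in> S. n mod C = n0 mod C}" by blast
  show ?thesis
  proof (intro exI conjI ballI)
    show "{n \<in> S. n mod C = n0 mod C} \<subseteq> S" by auto
    show "infinite {n \<in> S. n mod C = n0 mod C}" by fact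
    show "z ^ (card (UNIV :: 'a set) ^ n) = z ^ (card (UNIV :: 'a set) ^ n0)"
      if "z \<in> Z" "n \<in> {n \<in> S. n mod C = n0 mod C}" for z n
      using red[OF that(1), of n] red[OF that(1), of n0] that(2) by (simp add: q_def)
  qed
qed

section \<open>The trace identity over an unramified point\<close>

lemma subring_hom_fps_to_fls: "subring_hom UNIV (fps_to_fls :: 'k::field fps \<Rightarrow> _)"
  by (rule subring_homI) (simp_all add: fls_times_fps_to_fls)

lemma subring_hom_fps_const: "subring_hom UNIV (fps_const :: 'k::field \<Rightarrow> _)"
  by (rule subring_homI) simp_all

lemma subring_hom_to_ac: "subring_hom UNIV (to_ac :: 'k::field \<Rightarrow> _)"
  by (rule subring_homI) simp_all

lemma subring_hom_comp:
  assumes "subring_hom UNIV g" "subring_hom UNIV h"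
  shows "subring_hom UNIV (\<lambda>x. g (h x))"
  using subring_homD[OF assms(1)] subring_homD[OF assms(2)] by (intro subring_homI) simp_all

lemma map_poly_pderiv:
  assumes "subring_hom UNIV h"
  shows "map_poly h (pderiv p) = pderiv (map_poly h p)"
proof (rule poly_eqI)
  have "h (of_nat n) = of_nat n" for n
    by (induction n) (simp_all add: subring_hom_0[OF assms] subring_hom_add[OF assms] subring_homD[OF assms])
  then show "coeff (map_poly h (pderiv p)) n = coeff (pderiv (map_poly h p)) n" for n
    using subring_homD(6)[OF assms] by (simp add: coeff_map_poly coeff_pderiv subring_hom_0[OF assms] del: of_nat_Suc)
qed

text \<open>In characteristic p a power with exponent p^k > 1 has no linear term.\<close>

lemma fps_linear_not_frobenius_fixed:
  fixes t0 :: "'a::{field,finite} alg_closure"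
  assumes "n \<ge> 1"
  shows "(fps_const t0 + fps_X) ^ (card (UNIV :: 'a set) ^ n) \<noteq> fps_const t0 + fps_X"
proof
  define Q where "Q = card (UNIV :: 'a set) ^ n"
  define t where "t = fps_const t0 + fps_X"
  assume "(fps_const t0 + fps_X) ^ (card (UNIV :: 'a set) ^ n) = fps_const t0 + fps_X"
  then have "t ^ Q = t" by (simp add: Q_def t_def)
  have Q: "Q > 1" unfolding Q_def by (intro one_less_power finite_field_card_gt_1) (use assms in simp)
  obtain k where k: "Q = CHAR('a) ^ k" unfolding Q_def using card_power_CHAR_power by blast
  have "t ^ Q = fps_const ((t $ 0) ^ Q) + fps_X ^ Q * fps_shift 1 t ^ Q"
    by (rule fps_power_frobenius[where k = k]) (use k prime_CHAR_finite[where 'a = 'a] in simp_all)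
  then have "(t ^ Q) $ 1 = 0" using Q by (simp add: fps_X_power_mult_nth)
  moreover have "t $ 1 = 1" by (simp add: t_def)
  ultimately show False by (simp only: \<open>t ^ Q = t\<close> one_neq_zero)
qed

text \<open>Here \<open>fps_X\<close> stands for t - t0. The trace identity is expanded so that n
  enters only through the last exponent; the nonzero constant term of the derivative makes its
  inverse a power series, so no denominators remain.\<close>

lemma unramified_relation:
  fixes f :: "'a::{field,finite} poly"
  defines "F \<equiv> map_poly (\<lambda>c. fps_const (to_ac c)) f"
  assumes sep: "pderiv f \<noteq> 0"
  shows "\<exists>t0 R. finite R \<and> (\<forall>r\<in>R. poly F r = fps_const t0 + fps_X \<and> poly (pderiv F) r $ 0 \<noteq> 0) \<and>
    (\<forall>n\<ge>1. bij_betw (\<lambda>c. poly (map_poly to_ac f) c) (ff_ext n :: 'a alg_closure set) (ff_ext n) \<longrightarrow>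
      (\<Sum>r\<in>R. \<Sum>k\<le>degree f. \<Sum>i<k. coeff F k * r ^ (k - Suc i) * inverse (poly (pderiv F) r) *
          (r ^ i) ^ (card (UNIV :: 'a set) ^ n)) = 1)"
proof -
  define g where "g = map_poly to_ac f"
  have "map_poly to_ac (pderiv f) \<noteq> 0" using sep by (subst map_poly_eq_0_iff) auto
  then have "pderiv g \<noteq> 0" unfolding g_def map_poly_pderiv[OF subring_hom_to_ac] .
  then obtain t0 where t0: "\<And>c. poly g c = t0 \<Longrightarrow> poly (pderiv g) c \<noteq> 0" and card: "card {c. poly g c = t0} = degree g"
    using unramified_value_exists by blast
  have Fg: "F = map_poly fps_const g" by (simp add: F_def g_def map_poly_map_poly o_def)
  have deg: "degree g = degree f" unfolding g_def by (rule map_poly_degree_eq) (use sep in auto)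
  have "degree f > 0" using sep by (metis degree_eq_zeroE gr0I pCons_0_0 pderiv_0 pderiv_pCons add.right_neutral)
  define C where "C = {c. poly g c = t0}"
  have "card C > 0" using card deg \<open>degree f > 0\<close> by (simp add: C_def)
  then have "finite C" "C \<noteq> {}" by (simp_all add: card_gt_0_iff)
  have "\<forall>c\<in>C. \<exists>r. r $ 0 = c \<and> poly F r = fps_const t0 + fps_X"
    using fps_simple_root_exists[of g] t0 by (auto simp: C_def Fg)
  then obtain s where s: "\<And>c. c \<in> C \<Longrightarrow> s c $ 0 = c" "\<And>c. c \<in> C \<Longrightarrow> poly F (s c) = fps_const t0 + fps_X"
    by metis
  define R where "R = s ` C"
  have "inj_on s C" using s(1) by (metis inj_onI)
  then have R: "finite R" "R \<noteq> {}" "card R = degree f"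
    using \<open>finite C\<close> \<open>C \<noteq> {}\<close> card deg by (auto simp: R_def card_image C_def)
  have root: "poly F r = fps_const t0 + fps_X" if "r \<in> R" for r using that s by (auto simp: R_def)
  have simple: "poly (pderiv F) r $ 0 \<noteq> 0" if "r \<in> R" for r
  proof -
    obtain c where c: "c \<in> C" "r = s c" using \<open>r \<in> R\<close> by (auto simp: R_def)
    have "poly (map_poly fps_const p) r $ 0 = poly p (r $ 0)" for p
      by (induction p) (simp_all add: map_poly_pCons)
    then have "poly (pderiv F) r $ 0 = poly (pderiv g) c"
      using c s by (simp add: Fg flip: map_poly_pderiv[OF subring_hom_fps_const])
    then show ?thesis using t0 c by (simp add: C_def)
  qed
  \<comment> \<open>Partial fractions require a field, so the trace identity is applied to Laurent
    series and pulled back along the injective \<open>T\<close>.\<close>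
  define T where "T = (fps_to_fls :: 'a alg_closure fps \<Rightarrow> _)"
  have T: "subring_hom UNIV T" unfolding T_def by (rule subring_hom_fps_to_fls)
  have Tinj: "T x = T y \<longleftrightarrow> x = y" for x y by (simp add: T_def)
  define L where "L = map_poly T F"
  define \<kappa> where "\<kappa> c = T (fps_const c)" for c
  have \<kappa>: "subring_hom UNIV \<kappa>"
    unfolding \<kappa>_def by (rule subring_hom_comp[OF T subring_hom_fps_const])
  have L\<kappa>: "L = map_poly (\<lambda>c. \<kappa> (to_ac c)) f"
    by (simp add: L_def F_def map_poly_map_poly o_def subring_hom_0[OF T] \<kappa>_def)
  have ev: "poly L (T x) = T (poly F x)" for x
    using subring_hom_poly(2)[OF T polys_over_UNIV UNIV_I, of F x] by (simp add: L_def)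
  have ev': "poly (pderiv L) (T x) = T (poly (pderiv F) x)" for x
    using subring_hom_poly(2)[OF T polys_over_UNIV UNIV_I, of "pderiv F" x] by (simp add: L_def map_poly_pderiv[OF T])
  define t where "t = T (fps_const t0 + fps_X)"
  have degL: "degree L = degree f"
    unfolding L\<kappa> by (rule map_poly_degree_eq) (use sep in \<open>auto simp: \<kappa>_def T_def\<close>)
  then have dLt: "degree (L - [:t:]) = degree f"
    using \<open>degree f > 0\<close> unfolding diff_conv_add_uminus by (subst degree_add_eq_left) auto
  have "inj_on T R" using Tinj by (auto intro: inj_onI)
  \<comment> \<open>The constant terms are distinct, so \<open>R\<close> has as many elements as the
    degree and exhausts the roots.\<close>
  have split: "L - [:t:] = smult (lead_coeff (L - [:t:])) (\<Prod>r\<in>T ` R. [:- r, 1:])"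
    by (rule poly_splits_if_card_roots)
      (use R \<open>inj_on T R\<close> dLt in \<open>auto simp: card_image ev root t_def\<close>)
  have lead: "lead_coeff (L - [:t:]) \<noteq> 0"
    using dLt \<open>degree f > 0\<close> by (metis degree_0 leading_coeff_0_iff less_irrefl)
  have "(\<Sum>r\<in>R. \<Sum>k\<le>degree f. \<Sum>i<k. coeff F k * r ^ (k - Suc i) * inverse (poly (pderiv F) r) * (r ^ i) ^ Q) = 1"
    if n: "n \<ge> 1" and Q: "Q = card (UNIV :: 'a set) ^ n"
      and bij: "bij_betw (\<lambda>c. poly (map_poly to_ac f) c) (ff_ext n :: 'a alg_closure set) (ff_ext n)" for n Q
  proof -
    have CH: "CHAR('a alg_closure fls) = CHAR('a)" by simp
    have tQ: "t ^ Q \<noteq> t"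
      using fps_linear_not_frobenius_fixed[OF n, of t0] subring_hom_power(2)[OF T UNIV_I, of _ Q] Tinj
      unfolding t_def Q by metis
    have tr: "(\<Sum>r\<in>T ` R. (poly L (r ^ Q) - poly L r) / ((r ^ Q - r) * poly (pderiv L) r)) = 1"
      unfolding L\<kappa> Q
      by (rule trace_identity[OF CH n \<kappa> bij _ _ _ lead]) (use R split tQ in \<open>simp_all flip: L\<kappa> add: Q\<close>)
    have summand: "(poly L (T r ^ Q) - poly L (T r)) / ((T r ^ Q - T r) * poly (pderiv L) (T r))
        = T (\<Sum>k\<le>degree f. \<Sum>i<k. coeff F k * r ^ (k - Suc i) * inverse (poly (pderiv F) r) * (r ^ i) ^ Q)" (is "?l = ?r")
      if r: "r \<in> R" for r
    proof -
      have "poly L (T r ^ Q) = poly L (T r) ^ Q"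
        unfolding L\<kappa> Q by (rule poly_frobenius[OF subring_hom_comp[OF \<kappa> subring_hom_to_ac] CH])
      then have ne: "T r ^ Q - T r \<noteq> 0" using tQ root[OF r] by (auto simp: ev t_def)
      have inv: "inverse (T (poly (pderiv F) r)) = T (inverse (poly (pderiv F) r))"
        unfolding T_def by (rule fls_inverse_fps_to_fls) (use simple[OF r] in simp)
      have "?l = (\<Sum>k\<le>degree f. \<Sum>i<k. coeff L k * T r ^ (k - Suc i) * (T r ^ Q) ^ i) * inverse (T (poly (pderiv F) r))"
        using ne by (subst poly_difference_quotient[of L "degree f"]) (simp_all add: degL ev' divide_inverse)
      also have "\<dots> = (\<Sum>k\<le>degree f. \<Sum>i<k. T (coeff F k * r ^ (k - Suc i) * inverse (poly (pderiv F) r) * (r ^ i) ^ Q))"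
        unfolding sum_distrib_right inv
        by (intro sum.cong refl) (simp add: subring_homD[OF T] subring_hom_power[OF T] L_def coeff_map_poly
            subring_hom_0[OF T] mult_ac flip: power_mult)
      also have "\<dots> = ?r" by (simp add: subring_hom_sum[OF T])
      finally show ?thesis .
    qed
    have "T (\<Sum>r\<in>R. \<Sum>k\<le>degree f. \<Sum>i<k. coeff F k * r ^ (k - Suc i) * inverse (poly (pderiv F) r) * (r ^ i) ^ Q) = (\<Sum>r\<in>R. T (\<Sum>k\<le>degree f. \<Sum>i<k. coeff F k * r ^ (k - Suc i) * inverse (poly (pderiv F) r) * (r ^ i) ^ Q))"
      by (rule subring_hom_sum(2)[OF T UNIV_I])
    also have "\<dots> = (\<Sum>r\<in>R. (poly L (T r ^ Q) - poly L (T r)) / ((T r ^ Q - T r) * poly (pderiv L) (T r)))"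
      by (rule sum.cong[OF refl summand[symmetric]])
    also have "\<dots> = 1" using tr by (simp only: sum.reindex[OF \<open>inj_on T R\<close>] o_def)
    finally have "T (\<Sum>r\<in>R. \<Sum>k\<le>degree f. \<Sum>i<k. coeff F k * r ^ (k - Suc i) * inverse (poly (pderiv F) r) * (r ^ i) ^ Q) = 1" .
    then show ?thesis unfolding subring_homD(2)[OF T, symmetric] Tinj .
  qed
  then show ?thesis using R(1) root simple
    by (intro exI[of _ t0] exI[of _ R] conjI ballI allI impI) simp_all
qed

section \<open>Inertia at infinity\<close>

declare [[simproc del: poly_fps_eq]] \<comment> \<open>it turns equations between constant series into polynomial ones\<close>

lemma subring_hom_extend:
  fixes h :: "'l::field \<Rightarrow> 'm::alg_closed_field"
  assumes h: "subring_hom A h" and inj: "\<And>x. x \<in> A \<Longrightarrow> h x = 0 \<Longrightarrow> x = 0" and S: "finite S"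
    "\<And>x. x \<in> S \<Longrightarrow> \<exists>p\<in>polys_over {a / b | a b. a \<in> A \<and> b \<in> A}. p \<noteq> 0 \<and> poly p x = 0"
  shows "\<exists>K h'. subfield_hom K h' \<and> A \<subseteq> K \<and> S \<subseteq> K \<and> (\<forall>a\<in>A. h' a = h a)"
proof -
  obtain h0 where h0: "subfield_hom {a / b | a b. a \<in> A \<and> b \<in> A} h0" "\<forall>a\<in>A. h0 a = h a"
    using subring_hom_extend_fractions[OF h inj] by blast
  define B where "B = {a / b | a b. a \<in> A \<and> b \<in> A}"
  have A: "A \<subseteq> B"
  proof
    fix a assume "a \<in> A"
    then have "a / 1 \<in> B" using subring_homD(1)[OF h] unfolding B_def by blast
    then show "a \<in> B" by simp
  qed
  obtain K h' where K: "subfield_hom K h'" "B \<subseteq> K" "S \<subseteq> K" "\<forall>a\<in>B. h' a = h0 a"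
    using subfield_hom_extend_finite[OF h0(1) S] unfolding B_def by blast
  have "\<forall>a\<in>A. h' a = h a" using A K(4) h0(2) by (metis subsetD)
  then show ?thesis using K(1,3) order_trans[OF A K(2)] by (intro exI[of _ K] exI[of _ h'] conjI)
qed

text \<open>Over an algebraically closed field linear factors can be split off from \<open>p\<close>
  one by one, and \<open>s\<close> must be a zero of one of them.\<close>

lemma root_over_constants:
  fixes \<kappa> :: "'k::alg_closed_field \<Rightarrow> 'm::field"
  assumes \<kappa>: "subring_hom UNIV \<kappa>"
  shows "p \<noteq> 0 \<Longrightarrow> poly (map_poly \<kappa> p) s = 0 \<Longrightarrow> s \<in> range \<kappa>"
proof (induction "degree p" arbitrary: p rule: less_induct)
  case less
  note h0 = subring_hom_0(2)[OF \<kappa>] and h1 = subring_homD(2)[OF \<kappa>]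
  show ?case
  proof (cases "degree p = 0")
    case True
    then obtain c where c: "p = [:c:]" by (meson degree_eq_zeroE)
    have "subfield_hom UNIV \<kappa>" using \<kappa> by (simp add: subfield_hom_def)
    then show ?thesis using less.prems subfield_hom_eq_0_iff[of UNIV \<kappa> c] by (simp add: c map_poly_pCons h0)
  next
    case False
    then obtain x where "poly p x = 0" using alg_closed_imp_poly_has_root by blast
    then obtain r where r: "p = [:- x, 1:] * r" unfolding poly_eq_0_iff_dvd by (rule dvdE)
    then have "r \<noteq> 0" using less.prems by auto
    then have "degree r < degree p" unfolding r by (subst degree_mult_eq) auto
    have "map_poly \<kappa> p = map_poly \<kappa> [:- x, 1:] * map_poly \<kappa> r"
      unfolding r by (rule map_poly_hom[OF \<kappa>]) auto
    then have "poly (map_poly \<kappa> [:- x, 1:]) s * poly (map_poly \<kappa> r) s = 0"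
      using less.prems(2) by (metis poly_mult)
    then have "(s - \<kappa> x) * poly (map_poly \<kappa> r) s = 0"
      by (simp add: map_poly_pCons h0 h1 subring_hom_uminus[OF \<kappa>])
    then show ?thesis using less.hyps[OF \<open>degree r < degree p\<close> \<open>r \<noteq> 0\<close>] by auto
  qed
qed

text \<open>A model of the situation at infinity: \<open>fps_X\<close> is z with t = a / z^l, so an
  l-th root of the parameter is present from the start, and the algebraic closure contains all roots
  of f(X) = t.\<close>

definition fps_emb :: "'k::field fps \<Rightarrow> 'k fls alg_closure" where
  "fps_emb u = to_ac (fps_to_fls u)"

lemma subring_hom_fps_emb: "subring_hom UNIV fps_emb"
  unfolding fps_emb_def[abs_def] by (rule subring_hom_comp[OF subring_hom_to_ac subring_hom_fps_to_fls])

lemma fps_emb_eq_iff [simp]: "fps_emb u = fps_emb v \<longleftrightarrow> u = v"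
  by (simp add: fps_emb_def)

lemma fps_emb_eq_0_iff [simp]: "fps_emb u = 0 \<longleftrightarrow> u = 0"
  by (simp add: fps_emb_def)

abbreviation const_emb :: "'k::field \<Rightarrow> 'k fls alg_closure" where
  "const_emb c \<equiv> fps_emb (fps_const c)"

lemma subring_hom_const_emb: "subring_hom UNIV const_emb"
  by (rule subring_hom_comp[OF subring_hom_fps_emb subring_hom_fps_const])

text \<open>An \<open>s\<close> algebraic over the constants is itself constant; its sum with c
  times z^l then has constant term 0, unlike \<open>a\<close>. Hence t - c is transcendental for t =
  a / z^l.\<close>

lemma parameter_transcendental:
  fixes a :: "'k::alg_closed_field"
  assumes "a \<noteq> 0" "l > 0" and p: "p \<noteq> 0" "poly (map_poly const_emb p) s = 0"
  shows "(s + const_emb c) * fps_emb (fps_X ^ l) \<noteq> const_emb a"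
proof
  note hD = subring_homD[OF subring_hom_fps_emb] and hadd = subring_hom_add[OF subring_hom_fps_emb]
  assume *: "(s + const_emb c) * fps_emb (fps_X ^ l) = const_emb a"
  obtain b where "s = const_emb b"
    using root_over_constants[OF subring_hom_const_emb p] by blast
  then have "fps_emb ((fps_const b + fps_const c) * fps_X ^ l) = fps_emb (fps_const a)"
    using * by (simp only: hD(6)[OF UNIV_I UNIV_I] hadd(2)[OF UNIV_I UNIV_I])
  then have "(fps_const (b + c) * fps_X ^ l) $ 0 = fps_const a $ 0" by simp
  then show False using assms by simp
qed

text \<open>The substitution z -> \<zeta> z combined with x -> x^Q on the coefficients. For
  \<zeta>^l = 1 it fixes z^l, so apart from its effect on constants it belongs to inertia at
  infinity.\<close>

definition fps_twist :: "nat \<Rightarrow> 'k \<Rightarrow> 'k::field fps \<Rightarrow> 'k fps" where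
  "fps_twist Q \<zeta> u = Abs_fps (\<lambda>n. (u $ n) ^ Q * \<zeta> ^ n)"

lemma fps_twist_const [simp]: "fps_twist Q \<zeta> (fps_const c) = fps_const (c ^ Q)" if "Q > 0"
  by (rule fps_ext) (use that in \<open>simp add: fps_twist_def\<close>)

lemma fps_twist_X: "fps_twist Q \<zeta> fps_X = fps_const \<zeta> * fps_X" if "Q > 0"
  by (rule fps_ext) (use that in \<open>auto simp: fps_twist_def fps_X_def\<close>)

lemma subring_hom_fps_twist:
  fixes \<zeta> :: "'k::field"
  assumes Q: "subring_hom UNIV (\<lambda>x :: 'k. x ^ Q)"
  shows "subring_hom UNIV (fps_twist Q \<zeta>)"
proof (rule subring_homI)
  have 0: "(0 :: 'k) ^ Q = 0" using subring_hom_0(2)[OF Q] .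
  show "fps_twist Q \<zeta> 1 = 1" by (rule fps_ext) (auto simp: fps_twist_def 0)
  show "fps_twist Q \<zeta> (u - v) = fps_twist Q \<zeta> u - fps_twist Q \<zeta> v" for u v
    by (rule fps_ext) (simp add: fps_twist_def subring_homD(5)[OF Q] algebra_simps)
  show "fps_twist Q \<zeta> (u * v) = fps_twist Q \<zeta> u * fps_twist Q \<zeta> v" for u v
  proof (rule fps_ext)
    fix n
    have "fps_twist Q \<zeta> (u * v) $ n = (\<Sum>i=0..n. (u $ i * v $ (n - i)) ^ Q) * \<zeta> ^ n"
      by (simp add: fps_twist_def fps_mult_nth subring_hom_sum(2)[OF Q])
    also have "\<dots> = (\<Sum>i=0..n. ((u $ i) ^ Q * \<zeta> ^ i) * ((v $ (n - i)) ^ Q * \<zeta> ^ (n - i)))"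
      unfolding sum_distrib_right
    proof (rule sum.cong)
      fix i assume "i \<in> {0..n}"
      then have "\<zeta> ^ n = \<zeta> ^ i * \<zeta> ^ (n - i)" by (simp flip: power_add)
      then show "(u $ i * v $ (n - i)) ^ Q * \<zeta> ^ n = ((u $ i) ^ Q * \<zeta> ^ i) * ((v $ (n - i)) ^ Q * \<zeta> ^ (n - i))"
        by (simp add: power_mult_distrib mult_ac)
    qed simp
    also have "\<dots> = (fps_twist Q \<zeta> u * fps_twist Q \<zeta> v) $ n" by (simp add: fps_twist_def fps_mult_nth)
    finally show "fps_twist Q \<zeta> (u * v) $ n = (fps_twist Q \<zeta> u * fps_twist Q \<zeta> v) $ n" .
  qed
qed

lemma fps_twist_eq_0:
  fixes \<zeta> :: "'k::field"
  assumes "fps_twist Q \<zeta> u = 0" "\<zeta> \<noteq> 0" "Q > 0"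
  shows "u = 0"
proof (rule fps_ext)
  fix n
  have "fps_twist Q \<zeta> u $ n = 0" using assms(1) by simp
  then show "u $ n = 0 $ n" using assms by (simp add: fps_twist_def)
qed

text \<open>If \<open>x\<close> is fixed, so is W = V(1/x), because the coefficients of
  \<open>V\<close> become series in z^l over the field of order q. But W^l = z^l forces W = e z with
  e^l = 1, and \<open>\<sigma>\<close> sends e z to e \<zeta> z.\<close>

lemma no_fixed_root_at_infinity:
  fixes f :: "'a::{field,finite} poly" and x :: "'a alg_closure fls alg_closure"
  assumes deg: "degree f > 0" and l: "of_nat l \<noteq> (0 :: 'a)" "l dvd degree f"
    and \<zeta>: "\<zeta> ^ l = 1" "\<zeta> \<noteq> 1" and Q: "Q = card (UNIV :: 'a set) ^ \<rho>"
    and roots1: "\<And>e :: 'a alg_closure. e ^ l = 1 \<Longrightarrow> e ^ Q = e"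
    and \<sigma>: "subfield_hom K \<sigma>" "range fps_emb \<subseteq> K" "\<And>u. \<sigma> (fps_emb u) = fps_emb (fps_twist Q \<zeta> u)"
    and x: "x \<in> K" "poly (map_poly (\<lambda>c. const_emb (to_ac c)) f) x * fps_emb (fps_X ^ l) = const_emb (to_ac (lead_coeff f))"
  shows "\<sigma> x \<noteq> x"
proof
  assume fx: "\<sigma> x = x"
  have l0: "l > 0" using l by (auto intro: gr0I)
  have Q0: "Q > 0" by (simp add: Q card_gt_0_iff)
  note E = subring_hom_fps_emb
  have \<sigma>r: "subring_hom K \<sigma>" using \<sigma> by (simp add: subfield_hom_def)
  define z where "z = fps_emb (fps_X :: 'a alg_closure fps)"
  have z0: "z \<noteq> 0" by (simp add: z_def)
  define mac where "mac u = Abs_fps (\<lambda>n. to_ac (u $ n))" for u :: "'a fps"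
  have mac: "subring_hom UNIV mac"
    by (rule subring_homI) (auto simp: mac_def fps_eq_iff fps_mult_nth to_ac_sum)
  \<comment> \<open>Since f has coefficients in the field of order q, \<open>V\<close> can be built
    over series with such coefficients; \<open>\<phi>\<close> reads them as series in z^l over the
    algebraic closure.\<close>
  define \<phi> where "\<phi> u = fps_emb (mac (u oo fps_X ^ l))" for u
  have comp: "subring_hom UNIV (\<lambda>u :: 'a fps. u oo fps_X ^ l)"
    by (rule subring_homI) (use l0 in \<open>simp_all add: fps_compose_sub_distrib fps_compose_mult_distrib\<close>)
  have \<phi>: "subring_hom UNIV \<phi>"
    unfolding \<phi>_def by (rule subring_hom_comp[OF E subring_hom_comp[OF mac comp]])
  have inj: "u = 0" if "\<phi> u = 0" for u
  proof -
    have "mac (u oo fps_X ^ l) = 0" using that by (simp add: \<phi>_def)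
    then have "u oo fps_X ^ l = 0" by (simp add: mac_def fps_eq_iff)
    then show ?thesis using l0 by (simp add: fps_compose_eq_0_iff)
  qed
  have \<phi>c: "\<phi> (fps_const c) = const_emb (to_ac c)" for c
  proof -
    have "mac (fps_const c) = fps_const (to_ac c)" by (rule fps_ext) (simp add: mac_def)
    then show ?thesis by (simp add: \<phi>_def)
  qed
  have \<phi>X: "\<phi> fps_X = fps_emb (fps_X ^ l)"
  proof -
    have "mac (fps_X ^ l) = fps_X ^ l" by (rule fps_ext) (simp add: mac_def fps_X_power_nth)
    then show ?thesis using l0 by (simp add: \<phi>_def)
  qed
  \<comment> \<open>Only exponents divisible by l occur, where the power of \<zeta> is 1, and the
    Q-th power fixes the coefficients.\<close>
  have \<sigma>\<phi>: "\<sigma> (\<phi> u) = \<phi> u" for u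
  proof -
    define w where "w = u oo fps_X ^ l"
    have w: "w $ n = 0" if "\<not> l dvd n" for n
    proof -
      have "(u $ i) * ((fps_X ^ l) ^ i) $ n = 0" for i
      proof -
        have "n \<noteq> l * i" using that by auto
        then show ?thesis by (simp add: fps_X_power_nth flip: power_mult)
      qed
      then show ?thesis unfolding w_def fps_compose_nth by (intro sum.neutral) auto
    qed
    have "fps_twist Q \<zeta> (mac w) = mac w"
    proof (rule fps_ext)
      fix n
      show "fps_twist Q \<zeta> (mac w) $ n = mac w $ n"
      proof (cases "l dvd n")
        case True
        then obtain m where "n = l * m" by (rule dvdE)
        then have "\<zeta> ^ n = 1" by (simp add: power_mult \<zeta>)
        then show ?thesis using to_ac_power_card[of "w $ n" \<rho>] by (simp add: fps_twist_def mac_def Q)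
      next
        case False
        then show ?thesis using Q0 by (simp add: fps_twist_def mac_def w)
      qed
    qed
    then show ?thesis by (simp add: \<phi>_def \<sigma>(3) flip: w_def)
  qed
  have x0: "x \<noteq> 0"
  proof
    assume "x = 0"
    define a0 where "a0 = to_ac (coeff f 0)"
    have "poly (map_poly (\<lambda>c. const_emb (to_ac c)) f) x = const_emb a0"
      unfolding \<open>x = 0\<close> poly_0_coeff_0 by (simp add: coeff_map_poly a0_def subring_hom_0[OF E])
    then have "fps_emb (fps_const a0 * fps_X ^ l) = const_emb (to_ac (lead_coeff f))"
      using x(2) by (simp only: subring_homD(6)[OF E UNIV_I UNIV_I])
    then have "(fps_const a0 * fps_X ^ l) $ 0 = fps_const (to_ac (lead_coeff f)) $ 0" by simp
    then show False using l0 deg by auto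
  qed
  have fx': "poly (map_poly (\<lambda>c. \<phi> (fps_const c)) f) x * \<phi> fps_X = \<phi> (fps_const (lead_coeff f))"
    using x(2) by (simp only: \<phi>c \<phi>X)
  have inj': "\<forall>u. \<phi> u = 0 \<longrightarrow> u = 0" using inj by blast
  obtain V where V: "poly (map_poly \<phi> V) (inverse x) ^ l = \<phi> fps_X"
  proof -
    from root_at_infinity_exists[OF deg l, where 'm = "'a alg_closure fls alg_closure"]
    show ?thesis
      by (elim exE, elim allE[where x = \<phi>], elim allE[where x = x]) (use \<phi> inj' x0 fx' that in blast)
  qed
  define W where "W = poly (map_poly \<phi> V) (inverse x)"
  have "\<phi> u \<in> K" for u using \<sigma>(2) by (auto simp: \<phi>_def)
  then have pK: "map_poly \<phi> V \<in> polys_over K"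
    by (simp add: polys_over_def coeff_map_poly subring_hom_0[OF \<phi>])
  have ixK: "inverse x \<in> K" and \<sigma>ix: "\<sigma> (inverse x) = inverse x"
    using subfield_hom_inverse[OF \<sigma>(1) x(1)] fx by simp_all
  have "map_poly \<sigma> (map_poly \<phi> V) = map_poly \<phi> V"
    by (rule poly_eqI) (simp add: coeff_map_poly subring_hom_0[OF \<sigma>r] subring_hom_0[OF \<phi>] \<sigma>\<phi>)
  then have \<sigma>W: "\<sigma> W = W"
    using subring_hom_poly(2)[OF \<sigma>r pK ixK] by (simp_all add: W_def \<sigma>ix)
  have "W ^ l = z ^ l" using V by (simp add: W_def \<phi>X z_def subring_hom_power[OF E])
  then have "(W / z) ^ l = 1" using z0 by (simp add: power_divide)
  moreover have "map_poly const_emb (monom 1 l - (1 :: 'a alg_closure poly)) = monom 1 l - 1"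
  proof -
    have "const_emb (1 :: 'a alg_closure) = 1" "const_emb (0 :: 'a alg_closure) = 0"
      by (rule subring_homD(2)[OF subring_hom_const_emb], rule subring_hom_0(2)[OF subring_hom_const_emb])
    then show ?thesis
      by (simp add: map_poly_hom[OF subring_hom_const_emb] map_poly_monom map_poly_1' del: fps_const_1_eq_1 fps_const_0_eq_0)
  qed
  ultimately have "poly (map_poly const_emb (monom 1 l - 1)) (W / z) = 0"
    by (simp add: poly_monom)
  moreover have "monom 1 l - (1 :: 'a alg_closure poly) \<noteq> 0"
  proof
    assume "monom 1 l - (1 :: 'a alg_closure poly) = 0"
    then have "coeff (monom 1 l - (1 :: 'a alg_closure poly)) l = 0" by simp
    then show False using l0 by simp
  qed
  ultimately obtain e where e: "W / z = const_emb e"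
    using root_over_constants[OF subring_hom_const_emb] by blast
  have "fps_emb (fps_const (e ^ l)) = fps_emb 1"
    using \<open>(W / z) ^ l = 1\<close> subring_hom_power(2)[OF subring_hom_const_emb UNIV_I, of e l] subring_homD(2)[OF E]
    by (simp add: e)
  then have "fps_const (e ^ l) $ 0 = 1 $ 0" by (simp only: fps_emb_eq_iff)
  then have "e ^ l = 1" by simp
  then have eQ: "e ^ Q = e" by (rule roots1)
  have We: "W = fps_emb (fps_const e * fps_X)"
    using e z0 by (simp add: z_def field_simps subring_homD(6)[OF E])
  have "\<sigma> W = fps_emb (fps_const e * (fps_const \<zeta> * fps_X))"
  proof -
    have "subring_hom UNIV (fps_twist Q \<zeta>)"
      unfolding Q by (intro subring_hom_fps_twist subring_hom_power_card) simp
    then show ?thesis using Q0 by (simp add: We \<sigma>(3) subring_homD(6)[OF _ UNIV_I UNIV_I] fps_twist_X eQ)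
  qed
  then have "fps_const e * (fps_const \<zeta> * fps_X) = fps_const e * fps_X"
    using \<sigma>W We by simp
  then have "(fps_const e * (fps_const \<zeta> * fps_X)) $ 1 = (fps_const e * fps_X) $ 1" by simp
  then have "e * \<zeta> = e" by (simp add: mult.assoc)
  moreover have "e \<noteq> 0" using \<open>e ^ l = 1\<close> l0 by (auto simp: power_0_left)
  ultimately show False using \<zeta>(2) by simp
qed

section \<open>Degrees of exceptional polynomials\<close>

lemma subring_hom_transport:
  assumes e: "subring_hom UNIV e" "inj e" and g: "subring_hom UNIV g"
  shows "subring_hom (range e) (\<lambda>x. g (inv_into UNIV e x))"
proof -
  have eq: "inv_into UNIV e (e u) = u" for u using e(2) by simp
  note eD = subring_homD[OF e(1)] and gD = subring_homD[OF g]
  show ?thesis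
    unfolding subring_hom_def
  proof (intro conjI ballI)
    show "1 \<in> range e" by (metis eD(2) rangeI)
    show "g (inv_into UNIV e 1) = 1" by (metis eD(2) eq gD(2))
    fix x y assume "x \<in> range e" "y \<in> range e"
    then obtain u v where uv: "x = e u" "y = e v" by blast
    have d: "x - y = e (u - v)" and m: "x * y = e (u * v)" unfolding uv by (simp_all add: eD)
    show "x - y \<in> range e" "x * y \<in> range e" unfolding d m by (rule rangeI)+
    show "g (inv_into UNIV e (x - y)) = g (inv_into UNIV e x) - g (inv_into UNIV e y)" unfolding d unfolding uv eq by (simp add: gD)
    show "g (inv_into UNIV e (x * y)) = g (inv_into UNIV e x) * g (inv_into UNIV e y)" unfolding m unfolding uv eq by (simp add: gD)
  qed
qed

text \<open>The twist is injective on power series, so it extends to fractions and then to the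
  finitely many roots, which are algebraic over them.\<close>

lemma inertia_homomorphism_exists:
  fixes F :: "'k::field fps poly" and \<zeta> :: "'k::field"
  assumes Q: "subring_hom UNIV (\<lambda>x :: 'k. x ^ Q)" "Q > 0" and \<zeta>: "\<zeta> \<noteq> 0"
    and F: "map_poly fps_emb F \<noteq> 0"
  shows "\<exists>K \<sigma>. subfield_hom K \<sigma> \<and> range fps_emb \<subseteq> K \<and> {x. poly (map_poly fps_emb F) x = 0} \<subseteq> K \<and>
    (\<forall>u. \<sigma> (fps_emb u) = fps_emb (fps_twist Q \<zeta> u))"
proof -
  define g where "g u = fps_emb (fps_twist Q \<zeta> u)" for u
  define h where "h x = g (inv_into UNIV fps_emb x)" for x
  have inj: "inj (fps_emb :: 'k fps \<Rightarrow> _)" by (rule injI) simp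
  have g: "subring_hom UNIV g"
    unfolding g_def by (rule subring_hom_comp[OF subring_hom_fps_emb subring_hom_fps_twist[OF Q(1)]])
  have h: "subring_hom (range fps_emb) h"
    unfolding h_def by (rule subring_hom_transport[OF subring_hom_fps_emb inj g])
  have he: "h (fps_emb u) = g u" for u using inj by (simp add: h_def)
  have hinj: "x = 0" if "x \<in> range fps_emb" "h x = 0" for x
    using that fps_twist_eq_0[OF _ \<zeta> Q(2)] by (auto simp: he g_def)
  define P where "P = map_poly fps_emb F"
  have "P \<in> polys_over {a / b | a b. a \<in> range fps_emb \<and> b \<in> range fps_emb}"
  proof -
    have "fps_emb u = fps_emb u / fps_emb 1" for u :: "'k fps"
    proof -
      have "fps_emb (1 :: 'k fps) = 1" by (rule subring_homD(2)[OF subring_hom_fps_emb])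
      then show ?thesis by simp
    qed
    then show ?thesis by (auto simp: polys_over_def P_def coeff_map_poly)
  qed
  moreover have "P \<noteq> 0" using F by (simp add: P_def)
  ultimately obtain K \<sigma> where "subfield_hom K \<sigma>" "range fps_emb \<subseteq> K" "{x. poly P x = 0} \<subseteq> K"
    "\<forall>a\<in>range fps_emb. \<sigma> a = h a"
    using subring_hom_extend[OF h hinj poly_roots_finite[of P]] by blast
  then show ?thesis using he by (intro exI[of _ K] exI[of _ \<sigma>]) (simp add: P_def g_def)
qed

text \<open>As \<open>s\<close> is transcendental over the constants, sending X to \<open>s\<close>
  is injective on polynomials and extends to rational functions. The roots of \<open>F\<close> are
  algebraic over these, so the map extends further and carries power series at t0 to the closure at
  infinity.\<close>

lemma analytic_continuation_exists:
  fixes F :: "'k::alg_closed_field fps poly" and s :: "'k fls alg_closure"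
  assumes tr: "\<And>p. p \<noteq> 0 \<Longrightarrow> poly (map_poly const_emb p) s \<noteq> 0"
    and F: "\<And>i. coeff F i \<in> range fps_of_poly" "F \<noteq> 0"
  shows "\<exists>K \<iota>. subfield_hom K \<iota> \<and> (\<forall>p. fps_to_fls (fps_of_poly p) \<in> K \<and> \<iota> (fps_to_fls (fps_of_poly p)) = poly (map_poly const_emb p) s)
     \<and> (\<forall>r. poly F r = 0 \<longrightarrow> fps_to_fls r \<in> K)"
proof -
  define e where "e p = fps_to_fls (fps_of_poly p)" for p :: "'k poly"
  define g where "g p = poly (map_poly const_emb p) s" for p
  have e: "subring_hom UNIV e"
    by (rule subring_homI) (simp_all add: e_def fps_of_poly_diff fps_of_poly_mult fls_times_fps_to_fls)
  have inj: "inj e" by (rule injI) (simp add: e_def fps_of_poly_eq_iff)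
  have g: "subring_hom UNIV g"
  proof (rule subring_homI)
    have "const_emb (1 :: 'k) = 1" by (rule subring_homD(2)[OF subring_hom_const_emb])
    then show "g 1 = 1" unfolding g_def by (subst map_poly_1') simp_all
  qed (simp_all add: g_def map_poly_hom[OF subring_hom_const_emb])
  define h where "h x = g (inv_into UNIV e x)" for x
  have h: "subring_hom (range e) h" unfolding h_def by (rule subring_hom_transport[OF e inj g])
  have he: "h (e p) = g p" for p using inj by (simp add: h_def)
  have hinj: "x = 0" if "x \<in> range e" "h x = 0" for x
  proof -
    obtain p where "x = e p" using \<open>x \<in> range e\<close> by blast
    then have "poly (map_poly const_emb p) s = 0" using \<open>h x = 0\<close> by (simp add: he g_def)
    then have "p = 0" using tr by blast
    then show "x = 0" using \<open>x = e p\<close> subring_hom_0(2)[OF e] by simp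
  qed
  define P where "P = map_poly fps_to_fls F"
  have "P \<noteq> 0" using F(2) by (simp add: P_def map_poly_eq_0_iff)
  have root: "poly P (fps_to_fls r) = 0" if "poly F r = 0" for r
    using subring_hom_poly(2)[OF subring_hom_fps_to_fls polys_over_UNIV UNIV_I, of F r] that by (simp add: P_def)
  have "e u / e 1 = e u" for u using subring_homD(2)[OF e] by simp
  then have eA: "e u \<in> {a / b | a b. a \<in> range e \<and> b \<in> range e}" for u
    by (metis (mono_tags, lifting) mem_Collect_eq rangeI)
  have "P \<in> polys_over {a / b | a b. a \<in> range e \<and> b \<in> range e}"
    unfolding polys_over_def
  proof (rule CollectI, rule allI)
    fix i
    obtain u where "coeff P i = e u"
      using F(1)[of i] by (auto simp: P_def coeff_map_poly e_def)
    then show "coeff P i \<in> {a / b | a b. a \<in> range e \<and> b \<in> range e}" using eA[of u] by simp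
  qed
  then obtain K \<iota> where K: "subfield_hom K \<iota>" "range e \<subseteq> K" "{x. poly P x = 0} \<subseteq> K" "\<forall>a\<in>range e. \<iota> a = h a"
    using subring_hom_extend[OF h hinj poly_roots_finite[OF \<open>P \<noteq> 0\<close>]] \<open>P \<noteq> 0\<close> by blast
  show ?thesis
  proof (intro exI conjI allI impI)
    show "subfield_hom K \<iota>" by fact
    show "fps_to_fls (fps_of_poly p) \<in> K" for p using K(2) by (auto simp: e_def)
    show "\<iota> (fps_to_fls (fps_of_poly p)) = poly (map_poly const_emb p) s" for p
      using K(4) he[of p] by (simp add: e_def g_def)
    show "fps_to_fls r \<in> K" if "poly F r = 0" for r using K(3) root[OF that] by auto
  qed
qed

text \<open>If 1 were the only solution, it would be a simple root of X^l - 1 because l is nonzero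
  in the field, and a separable polynomial with a single root has degree 1.\<close>

lemma nontrivial_root_of_unity_exists:
  assumes "of_nat l \<noteq> (0 :: 'k::alg_closed_field)" "l > 1"
  shows "\<exists>\<zeta> :: 'k. \<zeta> ^ l = 1 \<and> \<zeta> \<noteq> 1"
proof (rule ccontr)
  assume "\<not> (\<exists>\<zeta> :: 'k. \<zeta> ^ l = 1 \<and> \<zeta> \<noteq> 1)"
  then have "{x :: 'k. x ^ l = 1} = {1}" by auto
  define p where "p = monom 1 l - (1 :: 'k poly)"
  have roots: "{x. poly p x = 0} = {1}"
    using \<open>{x :: 'k. x ^ l = 1} = {1}\<close> by (simp add: p_def poly_monom)
  have "coeff p l = 1" using assms by (simp add: p_def)
  then have "degree p \<ge> l" by (intro le_degree) simp
  then have "p \<noteq> 0" using assms by auto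
  have "card {x. poly p x = 0} = degree p"
  proof (rule separable_splits(2)[OF _ \<open>p \<noteq> 0\<close>])
    fix x assume "poly p x = 0"
    then have "x = 1" using roots by auto
    then show "poly (pderiv p) x \<noteq> 0"
      using assms by (simp add: p_def pderiv_diff pderiv_monom poly_monom)
  qed
  then show False using roots \<open>degree p \<ge> l\<close> assms by simp
qed

lemma exceptional_separable:
  fixes f :: "'a::{field,finite} poly"
  assumes ex: "exceptional f" and sep: "pderiv f \<noteq> 0"
    and l: "l dvd degree f" "l dvd card (UNIV :: 'a set) - 1"
  shows "l = 1"
proof (rule ccontr)
  assume "l \<noteq> 1"

  \<comment> \<open>A nontrivial l-th root of unity\<close>
  define q where "q = card (UNIV :: 'a set)"
  have q1: "q > 1" unfolding q_def by (rule finite_field_card_gt_1)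
  have deg: "degree f > 0"
    using sep by (metis degree_eq_zeroE gr0I pCons_0_0 pderiv_0 pderiv_pCons add.right_neutral)
  have "l \<noteq> 0" using l(1) deg by auto
  then have "l > 1" using \<open>l \<noteq> 1\<close> by simp
  obtain m where "q - 1 = l * m" using l(2) unfolding q_def by (rule dvdE)
  \<comment> \<open>From q = 1 + l m it follows that l is nonzero in the field and that e^l = 1
    implies e^q = e.\<close>
  then have qm: "q = Suc (l * m)" using q1 by simp
  have "of_nat q = (0 :: 'a)"
    using of_nat_card_finite_field[of 1, where 'a = 'a and 'l = 'a] by (simp add: q_def)
  then have lnz: "of_nat l \<noteq> (0 :: 'a)" unfolding qm by auto
  then have "of_nat l \<noteq> (0 :: 'a alg_closure)" by (metis to_ac_eq_0_iff to_ac_of_nat)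
  then obtain \<zeta> :: "'a alg_closure" where \<zeta>: "\<zeta> ^ l = 1" "\<zeta> \<noteq> 1"
    using nontrivial_root_of_unity_exists \<open>l > 1\<close> by blast
  have \<zeta>0: "\<zeta> \<noteq> 0" using \<zeta>(1) \<open>l > 1\<close> by (auto simp: power_0_left)
  have roots1: "e ^ q ^ n = e" if "e ^ l = 1" for e :: "'a alg_closure" and n
  proof (induction n)
    case (Suc n)
    have "e ^ q = e" unfolding qm using that by (simp add: power_mult)
    then show ?case using Suc by (simp add: power_mult)
  qed simp

  \<comment> \<open>The trace relation as a linear relation with one Frobenius power\<close>
  define T where "T = (fps_to_fls :: 'a alg_closure fps \<Rightarrow> _)"
  have T: "subring_hom UNIV T" unfolding T_def by (rule subring_hom_fps_to_fls)
  define F where "F = map_poly (\<lambda>c. fps_const (to_ac c)) f"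
  obtain t0 R where R: "finite R"
    and R1: "\<forall>r\<in>R. poly F r = fps_const t0 + fps_X \<and> poly (pderiv F) r $ 0 \<noteq> 0"
    and R2: "\<forall>n\<ge>1. bij_betw (\<lambda>c. poly (map_poly to_ac f) c) (ff_ext n :: 'a alg_closure set) (ff_ext n) \<longrightarrow>
      (\<Sum>r\<in>R. \<Sum>k\<le>degree f. \<Sum>i<k. coeff F k * r ^ (k - Suc i) * inverse (poly (pderiv F) r) * (r ^ i) ^ q ^ n) = 1"
    using unramified_relation[OF sep, folded F_def q_def] by (elim exE conjE) (rule that)
  have root: "poly F r = fps_const t0 + fps_X" and simple: "poly (pderiv F) r $ 0 \<noteq> 0" if "r \<in> R" for r
    using R1 that by blast+
  \<comment> \<open>\<open>None\<close> carries the constant -1, which makes the relation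
    homogeneous; \<open>Some (r, k, i)\<close> indexes the terms of the expanded difference
    quotients.\<close>
  define J where "J = insert None (Some ` (SIGMA r:R. SIGMA k:{..degree f}. {..<k}))"
  define b where "b = case_option (- 1) (\<lambda>(r, k, i). coeff F k * r ^ (k - Suc i) * inverse (poly (pderiv F) r))"
  define y :: "('a alg_closure fps \<times> nat \<times> nat) option \<Rightarrow> 'a alg_closure fps"
    where "y = case_option 1 (\<lambda>(r, k, i). r ^ i)"
  have finJ: "finite J" unfolding J_def using R by (intro finite.insertI finite_imageI finite_SigmaI) auto
  have sumJ: "(\<Sum>j\<in>J. w j) = w None + (\<Sum>r\<in>R. \<Sum>k\<le>degree f. \<Sum>i<k. w (Some (r, k, i)))"
    for w :: "_ \<Rightarrow> 'z::comm_monoid_add"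
  proof -
    have "(\<Sum>j\<in>J. w j) = w None + (\<Sum>j\<in>Some ` (SIGMA r:R. SIGMA k:{..degree f}. {..<k}). w j)"
      unfolding J_def by (rule sum.insert) (use R in \<open>auto intro!: finite_imageI finite_SigmaI\<close>)
    also have "(\<Sum>j\<in>Some ` (SIGMA r:R. SIGMA k:{..degree f}. {..<k}). w j)
        = (\<Sum>(r, k, i)\<in>(SIGMA r:R. SIGMA k:{..degree f}. {..<k}). w (Some (r, k, i)))"
      by (subst sum.reindex) (auto simp: o_def case_prod_unfold)
    also have "\<dots> = (\<Sum>r\<in>R. \<Sum>(k, i)\<in>(SIGMA k:{..degree f}. {..<k}). w (Some (r, k, i)))"
      using R by (subst sum.Sigma) auto
    also have "\<dots> = (\<Sum>r\<in>R. \<Sum>k\<le>degree f. \<Sum>i<k. w (Some (r, k, i)))"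
      by (subst sum.Sigma) auto
    finally show ?thesis .
  qed
  \<comment> \<open>\<open>M\<close> depends only on the series \<open>y j\<close>, so it is
    available before \<rho> is chosen.\<close>
  obtain M where M: "finite M" and
    Mrel: "\<And>A h (c :: _ \<Rightarrow> 'a alg_closure fls alg_closure). subring_hom A h \<Longrightarrow> range fps_const \<subseteq> A \<Longrightarrow> y ` J \<subseteq> A \<Longrightarrow>
      (\<forall>m\<in>M. (\<Sum>j\<in>J. c j * h (fps_const (y j $ m))) = 0) \<Longrightarrow> (\<Sum>j\<in>J. c j * h (y j)) = 0"
    using linear_relation_from_coeffs[OF finJ, of y] by blast
  \<comment> \<open>\<open>Z\<close> collects all coefficients up to the largest position in
    \<open>M\<close>; the 0 covers an empty \<open>M\<close>.\<close>
  define B where "B = Max (insert 0 M)"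
  define Z where "Z = (\<lambda>(j, i). y j $ i) ` (J \<times> {..B})"
  have "finite Z" unfolding Z_def using finJ by blast
  define E where "E = {n. n \<ge> 1 \<and> bij_betw (\<lambda>c. poly (map_poly to_ac f) c) (ff_ext n :: 'a alg_closure set) (ff_ext n)}"
  have "infinite E" using ex by (simp add: exceptional_def E_def)
  obtain \<rho> N where N: "N \<subseteq> E" "infinite N" "\<And>z n. z \<in> Z \<Longrightarrow> n \<in> N \<Longrightarrow> z ^ q ^ n = z ^ q ^ \<rho>"
    using frobenius_class_infinite[OF \<open>finite Z\<close> \<open>infinite E\<close>] unfolding q_def by blast
  define Q where "Q = q ^ \<rho>"
  have Q0: "Q > 0" using q1 by (simp add: Q_def)
  have powQ: "subring_hom UNIV (\<lambda>x :: 'a alg_closure. x ^ Q)"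
    unfolding Q_def q_def by (rule subring_hom_power_card) simp
  have coeffs: "(\<Sum>j\<in>J. b j * fps_const ((y j $ m) ^ Q)) = 0" if "m \<in> M" for m
  proof (rule fps_frobenius_relation_coeffs[where N = N and Q = "\<lambda>n. q ^ n" and g = "\<lambda>z. z ^ Q"])
    show "prime CHAR('a alg_closure)" using prime_CHAR_finite[where 'a = 'a] by simp
    show "\<exists>k. q ^ n = CHAR('a alg_closure) ^ k" for n using card_power_CHAR_power[of n, where 'a = 'a] by (simp add: q_def)
    show "inj_on (\<lambda>n. q ^ n) N" using q1 by (auto intro: inj_onI)
    show "infinite N" by fact
    show "(y j $ i) ^ q ^ n = (y j $ i) ^ Q" if "j \<in> J" "i \<le> m" "n \<in> N" for j i n
    proof -
      have "m \<le> B" unfolding B_def using M \<open>m \<in> M\<close> by (intro Max_ge) auto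
      then have "y j $ i \<in> Z" unfolding Z_def using that by (auto intro!: image_eqI[of _ _ "(j, i)"])
      then show ?thesis using N(3) that(3) by (simp add: Q_def)
    qed
    show "(\<Sum>j\<in>J. b j * y j ^ q ^ n) = 0" if "n \<in> N" for n
    proof -
      have "n \<in> E" using that N(1) by blast
      then show ?thesis unfolding sumJ using R2 by (simp add: b_def y_def E_def)
    qed
  qed

  \<comment> \<open>The parameter at infinity and an inertia homomorphism fixing it\<close>
  define G where "G = map_poly fps_emb F"
  have GF: "G = map_poly (\<lambda>c. const_emb (to_ac c)) f"
    unfolding G_def F_def by (rule poly_eqI) (simp add: coeff_map_poly)
  define a where "a = to_ac (lead_coeff f)"
  have "a \<noteq> 0" using deg by (auto simp: a_def)
  define zl where "zl = fps_emb (fps_X ^ l :: 'a alg_closure fps)"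
  have zl0: "zl \<noteq> 0" by (simp add: zl_def)
  define t where "t = const_emb a / zl"
  have tz: "t * zl = const_emb a" using zl0 by (simp add: t_def)
  note emb = subring_hom_fps_emb
  \<comment> \<open>Multiplying F(X) = a / z^l by z^l brings the equation into polynomials over
    power series in z.\<close>
  define P where "P = smult (fps_X ^ l) F - [:fps_const a:]"
  have embP: "map_poly fps_emb P = smult zl G - [:const_emb a:]"
    unfolding P_def zl_def G_def
    by (rule poly_eqI) (simp add: coeff_map_poly coeff_pCons subring_homD[OF emb] split: nat.splits)
  have degG: "degree G = degree f" unfolding GF by (rule map_poly_degree_eq) (use deg in auto)
  have "map_poly fps_emb P \<noteq> 0"
  proof
    assume "map_poly fps_emb P = 0"
    then have "coeff (smult zl G - [:const_emb a:]) (degree f) = 0" by (simp add: embP)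
    then have "lead_coeff G = 0" using deg zl0 by (simp add: coeff_pCons degG split: nat.splits)
    then show False using degG deg by (metis degree_0 leading_coeff_0_iff less_irrefl)
  qed
  from inertia_homomorphism_exists[OF powQ Q0 \<zeta>0 this]
  obtain K2 \<sigma> where \<sigma>': "subfield_hom K2 \<sigma>" "range fps_emb \<subseteq> K2" "{x. poly (map_poly fps_emb P) x = 0} \<subseteq> K2"
    "\<forall>u. \<sigma> (fps_emb u) = fps_emb (fps_twist Q \<zeta> u)" by (elim exE conjE) (rule that)
  note \<sigma> = \<sigma>'(1-3) spec[OF \<sigma>'(4)]
  have \<sigma>r: "subring_hom K2 \<sigma>" using \<sigma>(1) by (simp add: subfield_hom_def)
  have rootK2: "x \<in> K2" if "poly G x = t" for x
  proof -
    have "poly (map_poly fps_emb P) x = 0" using that tz by (simp add: embP mult.commute)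
    then show ?thesis using \<sigma>(3) by blast
  qed

  \<comment> \<open>Continuation of the roots from t0 to infinity\<close>
  define s where "s = t - const_emb t0"
  have tr: "poly (map_poly const_emb p) s \<noteq> 0" if "p \<noteq> 0" for p
    using parameter_transcendental[OF \<open>a \<noteq> 0\<close> _ that, of l s t0] tz \<open>l > 1\<close> by (auto simp: s_def zl_def)
  define H where "H = F - [:fps_const t0 + fps_X:]"
  have Hc: "coeff H i \<in> range fps_of_poly" for i
  proof -
    have "coeff F i = fps_of_poly [:to_ac (coeff f i):]" by (simp add: F_def coeff_map_poly fps_of_poly_const)
    moreover have "coeff [:fps_const t0 + fps_X:] i = fps_of_poly (if i = 0 then [:t0, 1:] else 0)"
      by (cases i) (simp_all add: fps_of_poly_linear add.commute)
    ultimately have "coeff H i = fps_of_poly ([:to_ac (coeff f i):] - (if i = 0 then [:t0, 1:] else 0))"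
      by (simp only: H_def coeff_diff fps_of_poly_diff)
    then show ?thesis by blast
  qed
  have H0: "H \<noteq> 0"
  proof
    have degF: "degree F = degree f" unfolding F_def by (rule map_poly_degree_eq) (use deg in auto)
    assume "H = 0"
    then have "degree F = 0" by (simp add: H_def)
    then show False using degF deg by simp
  qed
  have "\<exists>K \<iota>. subfield_hom K \<iota> \<and>
      (\<forall>p. T (fps_of_poly p) \<in> K \<and> \<iota> (T (fps_of_poly p)) = poly (map_poly const_emb p) s) \<and>
      (\<forall>r. poly H r = 0 \<longrightarrow> T r \<in> K)"
    unfolding T_def by (rule analytic_continuation_exists[OF _ Hc H0]) (rule tr)
  then obtain K1 \<iota> where \<iota>': "subfield_hom K1 \<iota>"
    "\<forall>p. T (fps_of_poly p) \<in> K1 \<and> \<iota> (T (fps_of_poly p)) = poly (map_poly const_emb p) s"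
    "\<forall>r. poly H r = 0 \<longrightarrow> T r \<in> K1"
    by (elim exE conjE) (rule that)
  have \<iota>: "subfield_hom K1 \<iota>" "T (fps_of_poly p) \<in> K1"
    "\<iota> (T (fps_of_poly p)) = poly (map_poly const_emb p) s" "poly H r = 0 \<Longrightarrow> T r \<in> K1" for p r
    using \<iota>' by simp_all
  have \<iota>r: "subring_hom K1 \<iota>" using \<iota>(1) by (simp add: subfield_hom_def)
  have rK1: "T r \<in> K1" if "r \<in> R" for r using \<iota>(4) root[OF that] by (simp add: H_def)
  have \<iota>c: "T (fps_const c) \<in> K1" "\<iota> (T (fps_const c)) = const_emb c" for c
    using \<iota>(2,3)[of "[:c:]"] by (simp_all add: fps_of_poly_const map_poly_pCons)
  have \<iota>t: "\<iota> (T (fps_const t0 + fps_X)) = t"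
  proof -
    have "const_emb (1 :: 'a alg_closure) = 1" by (rule subring_homD(2)[OF subring_hom_const_emb])
    then show ?thesis using \<iota>(3)[of "[:t0, 1:]"]
      by (simp add: fps_of_poly_linear map_poly_pCons s_def add.commute)
  qed
  have ev: "T (poly (map_poly fps_const p) r) \<in> K1"
     "\<iota> (T (poly (map_poly fps_const p) r)) = poly (map_poly const_emb p) (\<iota> (T r))" if "r \<in> R" for p r
  proof -
    define p' where "p' = map_poly T (map_poly fps_const p)"
    have p': "p' \<in> polys_over K1"
      using \<iota>c by (simp add: p'_def polys_over_def coeff_map_poly subring_hom_0[OF T])
    have "T (poly (map_poly fps_const p) r) = poly p' (T r)"
      using subring_hom_poly(2)[OF T polys_over_UNIV UNIV_I] by (simp add: p'_def)
    moreover have "map_poly \<iota> p' = map_poly const_emb p"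
      by (rule poly_eqI) (simp add: p'_def coeff_map_poly subring_hom_0[OF T] subring_hom_0[OF \<iota>r] \<iota>c)
    ultimately show "T (poly (map_poly fps_const p) r) \<in> K1"
     "\<iota> (T (poly (map_poly fps_const p) r)) = poly (map_poly const_emb p) (\<iota> (T r))"
      using subring_hom_poly[OF \<iota>r p' rK1[OF that]] by simp_all
  qed
  define fac where "fac = map_poly to_ac f"
  have Ff: "F = map_poly fps_const fac" by (simp add: F_def fac_def map_poly_map_poly o_def)
  have Gf: "G = map_poly const_emb fac" unfolding GF fac_def by (rule poly_eqI) (simp add: coeff_map_poly)
  have dFf: "pderiv F = map_poly fps_const (pderiv fac)" unfolding Ff by (rule map_poly_pderiv[OF subring_hom_fps_const, symmetric])

  \<comment> \<open>The continued roots and their images under inertia\<close>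
  define rX where "rX r = \<iota> (T r)" for r
  define rY where "rY r = \<sigma> (rX r)" for r
  have GX: "poly G (rX r) = t" if "r \<in> R" for r
    using ev(2)[OF that, of fac] root[OF that] \<iota>t by (simp add: Gf rX_def flip: Ff)
  have XK2: "rX r \<in> K2" if "r \<in> R" for r using rootK2 GX that by blast
  have \<sigma>c: "\<sigma> (const_emb (to_ac c)) = const_emb (to_ac c)" for c
    using to_ac_power_card[of c \<rho>] Q0 by (simp add: \<sigma>(4) flip: q_def Q_def)
  have \<sigma>zl: "\<sigma> zl = zl"
  proof -
    have "fps_twist Q \<zeta> (fps_X ^ l) = (fps_const \<zeta> * fps_X) ^ l"
      using subring_hom_power(2)[OF subring_hom_fps_twist[OF powQ] UNIV_I, of \<zeta> fps_X l] Q0 by (simp add: fps_twist_X)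
    then show ?thesis by (simp add: zl_def \<sigma>(4) power_mult_distrib fps_const_power \<zeta>(1))
  qed
  have \<sigma>t: "\<sigma> t = t"
  proof -
    have "const_emb a \<in> K2" "zl \<in> K2" using \<sigma>(2) by (auto simp: zl_def)
    then have "\<sigma> t = \<sigma> (const_emb a) / \<sigma> zl" unfolding t_def by (rule subfield_hom_divide(2)[OF \<sigma>(1)])
    then show ?thesis by (simp add: a_def \<sigma>c \<sigma>zl t_def)
  qed
  have GY: "poly G (rY r) = t" if "r \<in> R" for r
  proof -
    have "G \<in> polys_over K2" using \<sigma>(2) by (auto simp: polys_over_def GF coeff_map_poly)
    moreover have "map_poly \<sigma> G = G"
      unfolding GF by (rule poly_eqI) (simp add: coeff_map_poly subring_hom_0[OF \<sigma>r] \<sigma>c)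
    ultimately show ?thesis
      using subring_hom_poly(2)[OF \<sigma>r _ XK2[OF that], of G] GX[OF that] \<sigma>t by (simp add: rY_def)
  qed
  have YX: "rY r \<noteq> rX r" if "r \<in> R" for r
    unfolding rY_def
  proof (rule no_fixed_root_at_infinity[OF deg lnz l(1) \<zeta>, where \<rho> = \<rho> and Q = Q and K = K2])
    show "poly (map_poly (\<lambda>c. const_emb (to_ac c)) f) (rX r) * fps_emb (fps_X ^ l) = const_emb (to_ac (lead_coeff f))"
      using GX[OF that] tz by (simp add: GF zl_def a_def)
  qed (use \<sigma> roots1 XK2[OF that] in \<open>simp_all add: Q_def q_def\<close>)
  \<comment> \<open>\<open>rX r\<close> and \<open>rY r\<close> are distinct and \<open>G\<close>
    takes the value t at both, so the difference quotient vanishes.\<close>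
  have dq: "(\<Sum>k\<le>degree f. \<Sum>i<k. coeff G k * rX r ^ (k - Suc i) * rY r ^ i) = 0" if "r \<in> R" for r
    using poly_difference_quotient[of G "degree f" "rY r" "rX r"] degG GX[OF that] GY[OF that] YX[OF that] by simp

  \<comment> \<open>Transport of the relation to infinity\<close>
  define A where "A = {u. T u \<in> K1 \<and> \<iota> (T u) \<in> K2}"
  \<comment> \<open>Only the \<open>y j\<close> go through \<open>\<sigma>\<close>; the coefficients
    \<open>b j\<close> are carried by \<open>\<iota>\<close> alone.\<close>
  define h where "h u = \<sigma> (\<iota> (T u))" for u
  have h: "subring_hom A h"
    unfolding subring_hom_def A_def h_def
    by (auto simp: subring_homD[OF T] subring_homD[OF \<iota>r] subring_homD[OF \<sigma>r])
  have cA: "range fps_const \<subseteq> A" using \<sigma>(2) by (auto simp: A_def \<iota>c)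
  have RA: "r \<in> A" if "r \<in> R" for r using rK1[OF that] XK2[OF that] by (simp add: A_def rX_def)
  have yA: "y ` J \<subseteq> A"
    using RA subring_hom_power(1)[OF h] subring_homD(1)[OF h] by (auto simp: J_def y_def)
  define D where "D r = poly (map_poly const_emb (pderiv fac)) (rX r)" for r
  have Tb: "T (b (Some (r, k, i))) = T (fps_const (to_ac (coeff f k))) * T r ^ (k - Suc i) * inverse (T (poly (pderiv F) r))"
    if "r \<in> R" for r k i
  proof -
    have "inverse (T (poly (pderiv F) r)) = T (inverse (poly (pderiv F) r))"
      unfolding T_def by (rule fls_inverse_fps_to_fls) (use simple[OF that] in simp)
    then show ?thesis
      by (simp add: b_def F_def coeff_map_poly subring_homD(6)[OF T] subring_hom_power(2)[OF T])
  qed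
  have bSome: "T (b (Some (r, k, i))) \<in> K1" "\<iota> (T (b (Some (r, k, i)))) = coeff G k * rX r ^ (k - Suc i) * inverse (D r)"
    if "r \<in> R" for r k i
  proof -
    define c where "c = T (fps_const (to_ac (coeff f k)))"
    define v where "v = inverse (T (poly (pderiv F) r))"
    have c: "c \<in> K1" "\<iota> c = coeff G k" by (simp_all add: c_def \<iota>c GF coeff_map_poly)
    have p: "T r ^ (k - Suc i) \<in> K1" "\<iota> (T r ^ (k - Suc i)) = rX r ^ (k - Suc i)"
      using subring_hom_power[OF \<iota>r rK1[OF that]] by (simp_all add: rX_def)
    have v: "v \<in> K1" "\<iota> v = inverse (D r)"
      using subfield_hom_inverse[OF \<iota>(1) ev(1)[OF that, of "pderiv fac"]] ev(2)[OF that, of "pderiv fac"]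
      by (simp_all add: v_def D_def rX_def flip: dFf)
    note cp = subring_homD(4,6)[OF \<iota>r c(1) p(1)]
    show "T (b (Some (r, k, i))) \<in> K1" "\<iota> (T (b (Some (r, k, i)))) = coeff G k * rX r ^ (k - Suc i) * inverse (D r)"
      using subring_homD(4,6)[OF \<iota>r cp(1) v(1)] by (simp_all add: Tb[OF that] cp c p v flip: c_def v_def)
  qed
  have bNone: "T (b None) \<in> K1" "\<iota> (T (b None)) = - 1"
  proof -
    have "T (b None) = - 1" using subring_hom_uminus(2)[OF T UNIV_I, of 1] subring_homD(2)[OF T] by (simp add: b_def)
    then show "T (b None) \<in> K1" "\<iota> (T (b None)) = - 1"
      using subring_hom_uminus[OF \<iota>r subring_homD(1)[OF \<iota>r]] subring_homD(2)[OF \<iota>r] by simp_all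
  qed
  have bK1: "T (b j) \<in> K1" if "j \<in> J" for j
    using that bNone(1) bSome(1) by (auto simp: J_def)
  have "(\<Sum>j\<in>J. \<iota> (T (b j)) * h (y j)) = 0"
  proof (rule Mrel[OF h cA yA], rule ballI)
    fix m assume "m \<in> M"
    \<comment> \<open>On constants \<open>\<sigma>\<close> is the Q-th power, so the relations that
      \<open>Mrel\<close> asks for are the images under \<open>\<iota>\<close> of those in
      \<open>coeffs\<close>.\<close>
    have hc: "h (fps_const c) = \<iota> (T (fps_const (c ^ Q)))" for c
      using Q0 by (simp add: h_def \<iota>c \<sigma>(4))
    have "(\<Sum>j\<in>J. \<iota> (T (b j)) * h (fps_const (y j $ m))) = (\<Sum>j\<in>J. \<iota> (T (b j) * T (fps_const ((y j $ m) ^ Q))))"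
      by (rule sum.cong) (simp_all only: hc subring_homD(6)[OF \<iota>r bK1 \<iota>c(1)])
    also have "\<dots> = \<iota> (\<Sum>j\<in>J. T (b j) * T (fps_const ((y j $ m) ^ Q)))"
      by (rule subring_hom_sum(2)[OF \<iota>r, symmetric]) (rule subring_homD(4)[OF \<iota>r bK1 \<iota>c(1)])
    also have "(\<Sum>j\<in>J. T (b j) * T (fps_const ((y j $ m) ^ Q))) = T (\<Sum>j\<in>J. b j * fps_const ((y j $ m) ^ Q))"
      by (simp only: subring_hom_sum(2)[OF T UNIV_I] subring_homD(6)[OF T UNIV_I UNIV_I])
    also have "\<dots> = 0" by (simp only: coeffs[OF \<open>m \<in> M\<close>] subring_hom_0(2)[OF T])
    finally show "(\<Sum>j\<in>J. \<iota> (T (b j)) * h (fps_const (y j $ m))) = 0" by (simp only: subring_hom_0(2)[OF \<iota>r])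
  qed
  moreover have "\<iota> (T (b None)) * h (y None) = - 1"
    using bNone(2) subring_homD(2)[OF h] by (simp add: y_def)
  moreover have "(\<Sum>r\<in>R. \<Sum>k\<le>degree f. \<Sum>i<k. \<iota> (T (b (Some (r, k, i)))) * h (y (Some (r, k, i)))) = 0"
  proof (rule sum.neutral, rule ballI)
    fix r assume rR: "r \<in> R"
    have hy: "h (y (Some (r, k, i))) = rY r ^ i" for k i
      using subring_hom_power(2)[OF h RA[OF rR], of i] by (simp add: y_def rY_def rX_def h_def)
    have "(\<Sum>k\<le>degree f. \<Sum>i<k. \<iota> (T (b (Some (r, k, i)))) * h (y (Some (r, k, i))))
        = (\<Sum>k\<le>degree f. \<Sum>i<k. inverse (D r) * (coeff G k * rX r ^ (k - Suc i) * rY r ^ i))"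
      unfolding bSome(2)[OF rR] hy by (intro sum.cong refl) (simp add: mult_ac)
    also have "\<dots> = inverse (D r) * (\<Sum>k\<le>degree f. \<Sum>i<k. coeff G k * rX r ^ (k - Suc i) * rY r ^ i)"
      by (simp only: sum_distrib_left)
    finally show "(\<Sum>k\<le>degree f. \<Sum>i<k. \<iota> (T (b (Some (r, k, i)))) * h (y (Some (r, k, i)))) = 0"
      using dq[OF rR] by simp
  qed
  \<comment> \<open>All terms coming from roots vanish, so the relation reads -1 = 0.\<close>
  ultimately show False unfolding sumJ by simp
qed

text \<open>A zero derivative leaves only exponents divisible by p, and each coefficient is a p-th
  power because Frobenius is surjective on a finite field.\<close>

lemma inseparable_is_CHAR_power:
  fixes f :: "'a::{field,finite} poly"
  assumes "pderiv f = 0"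
  shows "\<exists>g. f = g ^ CHAR('a)"
proof -
  define p where "p = CHAR('a)"
  have p: "prime p" unfolding p_def by (rule prime_CHAR_finite)
  have p0: "p > 0" using p by (simp add: prime_gt_0_nat)
  have add: "(x - y) ^ p = x ^ p - y ^ p" for x y :: 'a
  proof -
    have "((x - y) + y) ^ p = (x - y) ^ p + y ^ p"
      by (rule freshmans_dream) (use p in \<open>simp_all add: p_def\<close>)
    then show ?thesis by simp
  qed
  have "inj (\<lambda>x :: 'a. x ^ p)"
  proof (rule injI)
    fix x y :: 'a assume "x ^ p = y ^ p"
    then have "(x - y) ^ p = 0" by (simp add: add)
    then show "x = y" by simp
  qed
  then have "surj (\<lambda>x :: 'a. x ^ p)" by (simp add: finite_UNIV_inj_surj)
  then obtain s where s: "\<And>x :: 'a. s x ^ p = x" by (metis surjD)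
  define g where "g = (\<Sum>i\<le>degree f. monom (s (coeff f (p * i))) i)"
  have "g ^ p = (\<Sum>i\<le>degree f. (monom (s (coeff f (p * i))) i) ^ p)"
    unfolding g_def by (rule freshmans_dream_sum) (use p in \<open>simp_all add: p_def\<close>)
  also have "\<dots> = (\<Sum>i\<le>degree f. monom (coeff f (p * i)) (p * i))"
    by (simp add: monom_power s mult.commute)
  also have "\<dots> = f"
  proof (rule poly_eqI)
    fix n
    have "coeff (\<Sum>i\<le>degree f. monom (coeff f (p * i)) (p * i)) n
        = (\<Sum>i\<le>degree f. if p * i = n then coeff f n else 0)"
      unfolding coeff_sum by (intro sum.cong) auto
    also have "\<dots> = coeff f n"
    proof (cases "p dvd n")
      case True
      then obtain i where i: "n = p * i" by (rule dvdE)
      show ?thesis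
      proof (cases "n \<le> degree f")
        case True
        have "i \<le> p * i" using p0 by simp
        then have "i \<le> degree f" by (rule order_trans) (use True i in simp)
        then show ?thesis using p0 by (simp add: i)
      next
        case False
        then have "coeff f n = 0" by (simp add: coeff_eq_0)
        then show ?thesis by (simp cong: if_cong)
      qed
    next
      case False
      then have "n \<noteq> 0" by (intro notI) simp
      then obtain k where k: "n = Suc k" by (cases n) auto
      have "of_nat n * coeff f n = coeff (pderiv f) k" by (simp add: coeff_pderiv k del: of_nat_Suc)
      also have "\<dots> = 0" by (simp add: assms)
      finally have "coeff f n = 0" using False by (simp add: of_nat_eq_0_iff_char_dvd p_def)
      then show ?thesis by (simp cong: if_cong)
    qed
    finally show "coeff (\<Sum>i\<le>degree f. monom (coeff f (p * i)) (p * i)) n = coeff f n" .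
  qed
  finally show ?thesis unfolding p_def by metis
qed

text \<open>Injectivity of g^m implies that of g, and g maps the finite set \<open>ff_ext n\<close>
  into itself because it commutes with Frobenius.\<close>

lemma exceptional_root:
  fixes g :: "'a::{field,finite} poly"
  assumes "exceptional (g ^ m)"
  shows "exceptional g"
proof -
  have pw: "poly (map_poly to_ac (g ^ m)) c = poly (map_poly to_ac g) c ^ m" for c :: "'a alg_closure"
  proof -
    have "map_poly to_ac (g ^ m) = map_poly to_ac g ^ m"
      by (induction m) (simp_all add: map_poly_hom[OF subring_hom_to_ac])
    then show ?thesis by simp
  qed
  have "bij_betw (\<lambda>c. poly (map_poly to_ac g) c) (ff_ext n) (ff_ext n :: 'a alg_closure set)"
    if n: "n \<ge> 1" and b: "bij_betw (\<lambda>c. poly (map_poly to_ac (g ^ m)) c) (ff_ext n) (ff_ext n :: 'a alg_closure set)" for n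
  proof -
    have "inj_on (\<lambda>c. poly (map_poly to_ac g) c) (ff_ext n)"
      using bij_betw_imp_inj_on[OF b] unfolding pw by (auto simp: inj_on_def)
    moreover have "(\<lambda>c. poly (map_poly to_ac g) c) ` ff_ext n \<subseteq> ff_ext n"
      using poly_frobenius[OF subring_hom_to_ac, of g _ n] by (auto simp: ff_ext_def) metis
    ultimately show ?thesis
      using endo_inj_surj[OF ff_ext_splits(2)[OF n]] by (simp add: bij_betw_def)
  qed
  then show ?thesis
    using assms unfolding exceptional_def by (elim contrapos_nn finite_subset[rotated]) blast
qed

text \<open>For inseparable f = g^p the degree drops by the factor p. This p divides q while l
  divides q - 1, so l is coprime to p and still divides the degree of g; the descent ends in the
  separable case.\<close>

lemma exceptional_dvd_degree:
  fixes f :: "'a::{field,finite} poly"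
  assumes "exceptional f" "degree f > 0" "l dvd degree f" "l dvd card (UNIV :: 'a set) - 1"
  shows "l = 1"
  using assms
proof (induction "degree f" arbitrary: f rule: less_induct)
  case less
  define p where "p = CHAR('a)"
  have p: "prime p" unfolding p_def by (rule prime_CHAR_finite)
  show ?case
  proof (cases "pderiv f = 0")
    case False
    then show ?thesis using exceptional_separable less.prems by blast
  next
    case True
    obtain g where g: "f = g ^ p" using inseparable_is_CHAR_power[OF True] by (auto simp: p_def)
    have dg: "degree f = p * degree g" unfolding g
      using less.prems(2) g by (subst degree_power_eq) (auto simp: power_0_left split: if_splits)
    then have "degree g > 0" using less.prems(2) by (auto intro: gr0I)
    have "degree g < degree f" unfolding dg using \<open>degree g > 0\<close> prime_gt_1_nat[OF p] by simp
    have "coprime l p"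
    proof -
      have "of_nat (card (UNIV :: 'a set)) = (0 :: 'a)"
        using of_nat_card_finite_field[of 1, where 'a = 'a and 'l = 'a] by simp
      then have "p dvd card (UNIV :: 'a set)" by (simp add: of_nat_eq_0_iff_char_dvd p_def)
      moreover have "coprime (card (UNIV :: 'a set) - 1) (card (UNIV :: 'a set))"
        using finite_field_card_gt_1[where 'a = 'a] by (intro coprime_diff_one_left_nat) simp
      ultimately show ?thesis using less.prems(4) by (meson coprime_divisors)
    qed
    then have "l dvd degree g" using less.prems(3) unfolding dg by (simp add: coprime_dvd_mult_right_iff)
    moreover have "exceptional g" using less.prems(1) exceptional_root unfolding g by blast
    ultimately show ?thesis
      using less.hyps[OF \<open>degree g < degree f\<close> _ \<open>degree g > 0\<close>] less.prems(4) by blast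
  qed
qed

theorem mainTheorem1:
  fixes f :: "('a::{field,finite}) poly"
  assumes "exceptional f"
    and "degree f \<ge> 1"
  shows "gcd (degree f) (card (UNIV :: 'a set) - 1) = 1"
  by (rule exceptional_dvd_degree[OF assms(1)]) (use assms(2) in auto)

end
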